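(* Let $\mathbb{K}$ be a field, $V$ a two-dimensional $\mathbb{K}$-vector space, and $\mathcal{A}$ a finite set of distinct one-dimensional linear subspaces of $V$. Let $C,C'$ be finite maximal connected components of $\Lambda'$ with $d(C,C')=2$. If $\mu\in C$ and $\mu'\in C'$, then $\{\theta_\mu,\theta_{\mu'}\}$ is $S$-linearly independent. Moreover, if $C$ is any maximal connected component of $\Lambda'$ and $\mu,\mu'\in C$, then $\{\theta_\mu,\theta_{\mu'}\}$ is $S$-linearly dependent.
   Context: Let $S=\mathrm{Sym}(V^* )\cong\mathbb{K}[x,y]$, graded by polynomial degree; for $H\in\mathcal{A}$ fix $\alpha_H\in V^*$ with $\ker\alpha_H=H$. Let $\Lambda=\mathbb{N}^{|\mathcal{A}|}$, whose elements are multiplicities $\mu:\mathcal{A}\to\mathbb{N}$. For $\mu\in\Lambda$, $D(\mathcal{A},\mu)=\{\delta\in S\partial_x\oplus S\partial_y\mid \delta(\alpha_H)\in\alpha_H^{\mu_H}S\ \forall H\}$ is a free graded $S$-module of rank 2; if $(d_1,d_2)$ are the degrees of a homogeneous basis, $\Delta(\mu)=|d_1-d_2|$. Order $\Lambda$ componentwise, $|\mu|=\sum_H\mu_H$, $\mu\mathrel{\dot\subset}\nu$ means $\mu\subset\nu$ and $|\nu|=|\mu|+1$; the Hasse graph has edges $\{\mu,\nu\}$ with $\mu\mathrel{\dot\subset}\nu$, and connectivity of subsets of $\Lambda$ refers to the induced subgraph. $\Lambda'=\Delta^{-1}(\mathbb{Z}_{>0})$. For $\mu\in\Lambda'$, $\theta_\mu$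 denotes the element of smaller degree in a homogeneous basis $\{\theta_\mu,\theta'_\mu\}$ of $D(\mathcal{A},\mu)$ with $\deg\theta_\mu<\deg\theta'_\mu$; it is unique up to a nonzero scalar. $d(\mu,\nu)=\sum_H|\mu_H-\nu_H|$, and for $C,C'\subset\Lambda$, $d(C,C')=\min\{d(\mu,\mu')\mid\mu\in C,\mu'\in C'\}$. *)

theory Defs
  imports Complex_Main "HOL-Library.FuncSet" "HOL-Library.Product_Plus" "HOL-Computational_Algebra.Polynomial"
begin

section \<open>The graded ring \<open>S = K[x,y]\<close>\<close>

text \<open>
  \<open>S\<close> is the type \<open>'k poly poly\<close>: \<open>y\<close> is the outer variable and \<open>x\<close> the variable of the
  coefficients, so the coefficient of \<open>x ^ j * y ^ i\<close> in \<open>p\<close> is \<open>coeff (coeff p i) j\<close>.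
\<close>

definition var_x :: "'k::field poly poly" where
  "var_x = [:[:0, 1:]:]"

definition var_y :: "'k::field poly poly" where
  "var_y = [:0, 1:]"

definition homogeneous :: "nat \<Rightarrow> 'k::field poly poly \<Rightarrow> bool" where
  "homogeneous d p \<longleftrightarrow> (\<forall>i j. coeff (coeff p i) j \<noteq> 0 \<longrightarrow> i + j = d)"

definition partial_x :: "'k::field poly poly \<Rightarrow> 'k poly poly" where
  "partial_x p = map_poly pderiv p"

definition partial_y :: "'k::field poly poly \<Rightarrow> 'k poly poly" where
  "partial_y p = pderiv p"

text \<open>
  Once a basis \<open>(e1, e2)\<close> of \<open>V\<close> is chosen, \<open>x\<close> and \<open>y\<close> are the elements of the dual basis, and
  a linear form \<open>\<phi>\<close> on \<open>V\<close> is the element \<open>\<phi>(e1) x + \<phi>(e2) y\<close> of \<open>Sym(V*) = K[x,y]\<close>.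
\<close>

definition form_poly :: "'v \<Rightarrow> 'v \<Rightarrow> ('v \<Rightarrow> 'k::field) \<Rightarrow> 'k poly poly" where
  "form_poly e1 e2 \<phi> = [:[:\<phi> e1:]:] * var_x + [:[:\<phi> e2:]:] * var_y"


section \<open>Derivations\<close>

text \<open>The pair \<open>(f, g)\<close> stands for the derivation \<open>f \<partial>\<^sub>x + g \<partial>\<^sub>y\<close>.\<close>

type_synonym 'k derivation = "'k poly poly \<times> 'k poly poly"

definition der_apply :: "'k::field derivation \<Rightarrow> 'k poly poly \<Rightarrow> 'k poly poly" where
  "der_apply \<delta> p = fst \<delta> * partial_x p + snd \<delta> * partial_y p"

definition der_scale :: "'k::field poly poly \<Rightarrow> 'k derivation \<Rightarrow> 'k derivation" where
  "der_scale p \<delta> = (p * fst \<delta>, p * snd \<delta>)"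

definition der_homogeneous :: "nat \<Rightarrow> 'k::field derivation \<Rightarrow> bool" where
  "der_homogeneous d \<delta> \<longleftrightarrow> homogeneous d (fst \<delta>) \<and> homogeneous d (snd \<delta>)"

text \<open>
  Independence is that of the family \<open>(\<delta>, \<delta>')\<close>, not of its underlying set: a repeated
  derivation is dependent, although \<open>{\<delta>, \<delta>}\<close> as a set would be independent for \<open>\<delta> \<noteq> 0\<close>.
\<close>

definition S_independent :: "'k::field derivation \<Rightarrow> 'k derivation \<Rightarrow> bool" where
  "S_independent \<delta> \<delta>' \<longleftrightarrow>
     (\<forall>p q. der_scale p \<delta> + der_scale q \<delta>' = 0 \<longrightarrow> p = 0 \<and> q = 0)"

abbreviation S_dependent :: "'k::field derivation \<Rightarrow> 'k derivation \<Rightarrow> bool" where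
  "S_dependent \<delta> \<delta>' \<equiv> \<not> S_independent \<delta> \<delta>'"


section \<open>The multiplicity lattice\<close>

text \<open>In this section \<open>A\<close> is any finite index set, later the set of lines.\<close>

definition multiplicities :: "'h set \<Rightarrow> ('h \<Rightarrow> nat) set" where
  "multiplicities A = A \<rightarrow>\<^sub>E UNIV"

definition mult_le :: "'h set \<Rightarrow> ('h \<Rightarrow> nat) \<Rightarrow> ('h \<Rightarrow> nat) \<Rightarrow> bool" where
  "mult_le A \<mu> \<nu> \<longleftrightarrow> (\<forall>H\<in>A. \<mu> H \<le> \<nu> H)"

definition mult_size :: "'h set \<Rightarrow> ('h \<Rightarrow> nat) \<Rightarrow> nat" where
  "mult_size A \<mu> = (\<Sum>H\<in>A. \<mu> H)"

definition mult_covered :: "'h set \<Rightarrow> ('h \<Rightarrow> nat) \<Rightarrow> ('h \<Rightarrow> nat) \<Rightarrow> bool" where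
  "mult_covered A \<mu> \<nu> \<longleftrightarrow> mult_le A \<mu> \<nu> \<and> mult_size A \<nu> = mult_size A \<mu> + 1"

definition hasse_adjacent :: "'h set \<Rightarrow> ('h \<Rightarrow> nat) \<Rightarrow> ('h \<Rightarrow> nat) \<Rightarrow> bool" where
  "hasse_adjacent A \<mu> \<nu> \<longleftrightarrow> mult_covered A \<mu> \<nu> \<or> mult_covered A \<nu> \<mu>"

definition hasse_connected :: "'h set \<Rightarrow> ('h \<Rightarrow> nat) set \<Rightarrow> bool" where
  "hasse_connected A C \<longleftrightarrow>
     (\<forall>\<mu>\<in>C. \<forall>\<nu>\<in>C. (\<mu>, \<nu>) \<in> {(\<kappa>, \<rho>). \<kappa> \<in> C \<and> \<rho> \<in> C \<and> hasse_adjacent A \<kappa> \<rho>}\<^sup>*)"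

definition maximal_component :: "'h set \<Rightarrow> ('h \<Rightarrow> nat) set \<Rightarrow> ('h \<Rightarrow> nat) set \<Rightarrow> bool" where
  "maximal_component A L C \<longleftrightarrow>
     C \<noteq> {} \<and> C \<subseteq> L \<and> hasse_connected A C \<and>
     (\<forall>C'. C \<subseteq> C' \<and> C' \<subseteq> L \<and> hasse_connected A C' \<longrightarrow> C' = C)"

definition mult_dist :: "'h set \<Rightarrow> ('h \<Rightarrow> nat) \<Rightarrow> ('h \<Rightarrow> nat) \<Rightarrow> nat" where
  "mult_dist A \<mu> \<nu> = (\<Sum>H\<in>A. nat \<bar>int (\<mu> H) - int (\<nu> H)\<bar>)"

text \<open>The infimum of a nonempty set of naturals is its minimum, even if the set is infinite.\<close>

definition set_dist :: "'h set \<Rightarrow> ('h \<Rightarrow> nat) set \<Rightarrow> ('h \<Rightarrow> nat) set \<Rightarrow> nat" where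
  "set_dist A C C' = Inf {mult_dist A \<mu> \<mu>' | \<mu> \<mu>'. \<mu> \<in> C \<and> \<mu>' \<in> C'}"


section \<open>Logarithmic derivations and exponents\<close>

text \<open>Here \<open>\<alpha> H\<close> is the linear form defining \<open>H\<close>, as an element of \<open>S\<close>.\<close>

definition log_derivations ::
  "'h set \<Rightarrow> ('h \<Rightarrow> 'k::field poly poly) \<Rightarrow> ('h \<Rightarrow> nat) \<Rightarrow> 'k derivation set" where
  "log_derivations A \<alpha> \<mu> = {\<delta>. \<forall>H\<in>A. \<alpha> H ^ \<mu> H dvd der_apply \<delta> (\<alpha> H)}"

definition homogeneous_basis ::
  "'h set \<Rightarrow> ('h \<Rightarrow> 'k::field poly poly) \<Rightarrow> ('h \<Rightarrow> nat) \<Rightarrow> nat \<Rightarrow> nat \<Rightarrow>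
     'k derivation \<Rightarrow> 'k derivation \<Rightarrow> bool" where
  "homogeneous_basis A \<alpha> \<mu> d1 d2 \<theta> \<theta>' \<longleftrightarrow>
     \<theta> \<in> log_derivations A \<alpha> \<mu> \<and> \<theta>' \<in> log_derivations A \<alpha> \<mu> \<and>
     der_homogeneous d1 \<theta> \<and> der_homogeneous d2 \<theta>' \<and>
     S_independent \<theta> \<theta>' \<and>
     (\<forall>\<delta>\<in>log_derivations A \<alpha> \<mu>. \<exists>p q. \<delta> = der_scale p \<theta> + der_scale q \<theta>')"

text \<open>
  The description is well defined because \<open>log_derivations A \<alpha> \<mu>\<close> is a free graded module of
  rank 2, whose homogeneous bases all have the same degrees.
\<close>

definition exp_diff ::
  "'h set \<Rightarrow> ('h \<Rightarrow> 'k::field poly poly) \<Rightarrow> ('h \<Rightarrow> nat) \<Rightarrow> nat" where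
  "exp_diff A \<alpha> \<mu> =
     (THE n. \<exists>d1 d2 \<theta> \<theta>'. homogeneous_basis A \<alpha> \<mu> d1 d2 \<theta> \<theta>' \<and>
        n = nat \<bar>int d1 - int d2\<bar>)"

definition unbalanced_mults ::
  "'h set \<Rightarrow> ('h \<Rightarrow> 'k::field poly poly) \<Rightarrow> ('h \<Rightarrow> nat) set" where
  "unbalanced_mults A \<alpha> = {\<mu> \<in> multiplicities A. exp_diff A \<alpha> \<mu> > 0}"

definition is_lower_basis_element ::
  "'h set \<Rightarrow> ('h \<Rightarrow> 'k::field poly poly) \<Rightarrow> ('h \<Rightarrow> nat) \<Rightarrow> 'k derivation \<Rightarrow> bool" where
  "is_lower_basis_element A \<alpha> \<mu> \<theta> \<longleftrightarrow>
     (\<exists>d1 d2 \<theta>'. homogeneous_basis A \<alpha> \<mu> d1 d2 \<theta> \<theta>' \<and> d1 < d2)"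

end

theory Submission
  imports Defs
begin

text \<open>
  Saito's criterion gives \<open>d\<^sub>1 + d\<^sub>2 = |\<mu>|\<close> for the degrees of a homogeneous basis, so \<open>\<mu>\<close> lies in
  \<open>\<Lambda>'\<close> iff \<open>D(\<A>, \<mu>)\<close> contains a nonzero homogeneous \<open>\<delta>\<close> with \<open>2 deg \<delta> < |\<mu>|\<close>. If \<open>\<nu>\<close> covers \<open>\<mu>\<close>
  in \<open>\<Lambda>'\<close>, then \<open>det (\<theta>\<^sub>\<mu>, \<theta>\<^sub>\<nu>)\<close> is divisible by \<open>Q\<^sup>\<mu> = \<Prod>\<alpha>\<^sub>H\<^bsup>\<mu>(H)\<^esup>\<close>, whose degree \<open>|\<mu>|\<close> is too
  large, hence it vanishes; as dependence of nonzero derivations is transitive, components are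
  dependent. For two components at distance two it is therefore enough to treat one pair at
  distance two. The multiplicities between its members are not in \<open>\<Lambda>'\<close>, and a dependence would
  produce a derivation of too small degree for one of them.
\<close>

section \<open>Homogeneous polynomials\<close>

lemma poly_poly_eqI:
  assumes "\<And>i j. coeff (coeff p i) j = coeff (coeff q i) j"
  shows "p = q"
  using assms by (simp add: poly_eq_iff)

lemma coeff_coeff_mult:
  "coeff (coeff (p * q) i) j =
     (\<Sum>k\<le>i. \<Sum>l\<le>j. coeff (coeff p k) l * coeff (coeff q (i - k)) (j - l))"
  by (simp add: coeff_mult coeff_sum)

lemma homogeneousD: "homogeneous d p \<Longrightarrow> i + j \<noteq> d \<Longrightarrow> coeff (coeff p i) j = 0"
  unfolding homogeneous_def by blast

lemma homogeneousI: "(\<And>i j. i + j \<noteq> d \<Longrightarrow> coeff (coeff p i) j = 0) \<Longrightarrow> homogeneous d p"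
  unfolding homogeneous_def by blast

lemma homogeneous_0 [simp]: "homogeneous d 0"
  by (simp add: homogeneous_def)

lemma homogeneous_const: "homogeneous 0 [:[:c:]:]"
  by (auto simp: homogeneous_def coeff_pCons split: nat.splits)

lemma homogeneous_add: "homogeneous d p \<Longrightarrow> homogeneous d q \<Longrightarrow> homogeneous d (p + q)"
  by (rule homogeneousI) (simp add: homogeneousD)

lemma homogeneous_diff: "homogeneous d p \<Longrightarrow> homogeneous d q \<Longrightarrow> homogeneous d (p - q)"
  by (rule homogeneousI) (simp add: homogeneousD)

lemma homogeneous_mult:
  assumes "homogeneous d p" "homogeneous e q"
  shows "homogeneous (d + e) (p * q)"
  unfolding homogeneous_def
proof (intro allI impI)
  fix i j assume "coeff (coeff (p * q) i) j \<noteq> 0"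
  then obtain k where k: "k \<le> i"
      "(\<Sum>l\<le>j. coeff (coeff p k) l * coeff (coeff q (i - k)) (j - l)) \<noteq> 0"
    unfolding coeff_coeff_mult by (metis (no_types, lifting) atMost_iff sum.neutral)
  then obtain l where l: "l \<le> j" "coeff (coeff p k) l * coeff (coeff q (i - k)) (j - l) \<noteq> 0"
    by (metis (no_types, lifting) atMost_iff sum.neutral)
  then have "k + l = d" "(i - k) + (j - l) = e"
    using assms unfolding homogeneous_def by (metis mult_zero_left mult_zero_right)+
  with k l show "i + j = d + e" by linarith
qed

lemma homogeneous_power: "homogeneous d p \<Longrightarrow> homogeneous (n * d) (p ^ n)"
proof (induction n)
  case 0
  then show ?case using homogeneous_const[of 1] by (simp add: one_pCons)
next
  case (Suc n)
  then show ?case using homogeneous_mult[of d p "n * d" "p ^ n"] by simp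
qed

lemma homogeneous_prod:
  assumes "finite A" "\<And>H. H \<in> A \<Longrightarrow> homogeneous (d H) (p H)"
  shows "homogeneous (\<Sum>H\<in>A. d H) (\<Prod>H\<in>A. p H)"
  using assms
proof (induction A)
  case empty
  then show ?case using homogeneous_const[of 1] by (simp add: one_pCons)
next
  case (insert H A)
  then show ?case using homogeneous_mult[of "d H" "p H" "sum d A" "prod p A"] by simp
qed

lemma homogeneous_0E:
  assumes "homogeneous 0 p"
  obtains c where "p = [:[:c:]:]"
proof
  show "p = [:[:coeff (coeff p 0) 0:]:]"
  proof (rule poly_poly_eqI)
    fix i j
    show "coeff (coeff p i) j = coeff (coeff [:[:coeff (coeff p 0) 0:]:] i) j"
      using homogeneousD[OF assms, of i j] by (auto simp: coeff_pCons split: nat.splits)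
  qed
qed

section \<open>Homogeneous components and cancellation of homogeneous factors\<close>

definition hom_part :: "nat \<Rightarrow> 'k::field poly poly \<Rightarrow> 'k poly poly" where
  "hom_part n p = (\<Sum>i\<le>n. monom (monom (coeff (coeff p i) (n - i)) (n - i)) i)"

lemma coeff_hom_part:
  "coeff (coeff (hom_part n p) i) j = (if i + j = n then coeff (coeff p i) j else 0)"
proof -
  have "coeff (coeff (hom_part n p) i) j =
      (\<Sum>k\<le>n. if k = i then (if n - k = j then coeff (coeff p k) (n - k) else 0) else 0)"
    unfolding hom_part_def coeff_sum by (intro sum.cong) simp_all
  also have "\<dots> = (if i + j = n then coeff (coeff p i) j else 0)"
    by (subst sum.delta) auto
  finally show ?thesis .
qed

lemma homogeneous_hom_part: "homogeneous n (hom_part n p)"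
  by (auto simp: homogeneous_def coeff_hom_part split: if_splits)

lemma hom_part_homogeneous: "homogeneous n p \<Longrightarrow> hom_part n p = p"
  by (rule poly_poly_eqI) (simp add: coeff_hom_part homogeneousD)

lemma hom_part_add: "hom_part n (p + q) = hom_part n p + hom_part n q"
  by (rule poly_poly_eqI) (simp add: coeff_hom_part)

text \<open>In a coefficient of total degree \<open>n + e\<close>, a term of the convolution
  survives only if its factor from \<open>q\<close> has degree \<open>e\<close>, which leaves degree
  \<open>n\<close> for the factor from \<open>p\<close>.\<close>

lemma hom_part_mult:
  assumes "homogeneous e q"
  shows "hom_part (n + e) (p * q) = hom_part n p * q"
proof (rule poly_poly_eqI)
  fix i j
  show "coeff (coeff (hom_part (n + e) (p * q)) i) j = coeff (coeff (hom_part n p * q) i) j"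
  proof (cases "i + j = n + e")
    case True
    have "coeff (coeff p k) l * coeff (coeff q (i - k)) (j - l) =
        coeff (coeff (hom_part n p) k) l * coeff (coeff q (i - k)) (j - l)" if "k \<le> i" "l \<le> j" for k l
      using homogeneousD[OF assms, of "i - k" "j - l"] True that by (auto simp: coeff_hom_part)
    then show ?thesis
      unfolding coeff_hom_part[of "n + e"] coeff_coeff_mult using True by (auto intro!: sum.cong simp del: mult_cancel_right mult_cancel_left)
  next
    case False
    then show ?thesis
      using homogeneousD[OF homogeneous_mult[OF homogeneous_hom_part assms]]
      by (simp add: coeff_hom_part[of "n + e"])
  qed
qed

lemma hom_part_mult_less:
  assumes "homogeneous e q" "n < e"
  shows "hom_part n (p * q) = 0"
proof (rule poly_poly_eqI)
  fix i j
  have "coeff (coeff p k) l * coeff (coeff q (i - k)) (j - l) = 0"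
    if "i + j = n" "k \<le> i" "l \<le> j" for k l
    using homogeneousD[OF assms(1), of "i - k" "j - l"] assms(2) that by simp
  then show "coeff (coeff (hom_part n (p * q)) i) j = coeff (coeff 0 i) j"
    unfolding coeff_hom_part coeff_coeff_mult by (auto intro!: sum.neutral simp del: mult_eq_0_iff)
qed

text \<open>Comparing components of degree \<open>m\<close> gives
  \<open>p * q = hom_part (m - n) p * q\<close>, and \<open>q\<close> cancels in the domain
  \<open>S\<close>. This turns divisibility into degree inequalities.\<close>

lemma homogeneous_cancel:
  assumes "homogeneous n q" "q \<noteq> 0" "homogeneous m (p * q)" "p \<noteq> 0"
  shows "n \<le> m" "homogeneous (m - n) p"
proof -
  have "hom_part m (p * q) \<noteq> 0"
    using assms by (simp add: hom_part_homogeneous)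
  then show le: "n \<le> m"
    using hom_part_mult_less[OF assms(1)] by (metis not_le)
  have "p * q = hom_part (m - n) p * q"
    using hom_part_mult[OF assms(1), of "m - n" p] le assms(3) by (simp add: hom_part_homogeneous)
  then have "p = hom_part (m - n) p"
    using assms(2) by simp
  then show "homogeneous (m - n) p"
    by (metis homogeneous_hom_part)
qed

section \<open>Linear forms\<close>

definition lin_form :: "'k::field \<Rightarrow> 'k \<Rightarrow> 'k poly poly" where
  "lin_form a b = [:[:0, a:], [:b:]:]"

lemma form_poly_eq: "form_poly e1 e2 \<phi> = lin_form (\<phi> e1) (\<phi> e2)"
  by (simp add: form_poly_def lin_form_def var_x_def var_y_def)

lemma homogeneous_lin_form: "homogeneous 1 (lin_form a b)"
  by (auto simp: homogeneous_def lin_form_def coeff_pCons split: nat.splits)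

lemma lin_form_eq_0_iff: "lin_form a b = 0 \<longleftrightarrow> a = 0 \<and> b = 0"
  by (simp add: lin_form_def)

lemma is_unit_const: "c \<noteq> 0 \<Longrightarrow> is_unit [:[:c::'k::field:]:]"
  by (simp add: is_unit_const_poly_iff dvd_field_iff)

text \<open>Divisibility by this polynomial is vanishing at \<open>c\<close>, and evaluation at
  \<open>c\<close> has values in a domain.\<close>

lemma prime_elem_monic_linear: "prime_elem [:- c, 1:]" for c :: "'a::idom"
proof (rule prime_elemI)
  show "\<not> [:- c, 1:] dvd 1"
    by (simp flip: poly_eq_0_iff_dvd)
qed (auto simp flip: poly_eq_0_iff_dvd)

lemma lin_form_monic: "b \<noteq> 0 \<Longrightarrow> lin_form a b = [:[:b:]:] * [:- [:0, - (a / b):], 1:]"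
  by (simp add: lin_form_def)

text \<open>Up to a unit the form is \<open>x\<close>, a prime of the coefficient ring that stays
  prime in \<open>S\<close>, or it is monic and linear in \<open>y\<close>.\<close>

lemma prime_elem_lin_form:
  assumes "a \<noteq> 0 \<or> b \<noteq> 0"
  shows "prime_elem (lin_form a b)"
proof (cases "b = 0")
  case True
  have "prime_elem [:0::'a, 1:]"
    using prime_elem_monic_linear[of "0::'a"] by simp
  then have "prime_elem [:[:0::'a, 1:]:]"
    by (rule lift_prime_elem_poly)
  moreover have "lin_form a b = [:[:a:]:] * [:[:0, 1:]:]"
    using True by (simp add: lin_form_def)
  ultimately show ?thesis
    using True assms is_unit_const[of a] by (metis prime_elem_mult_unit_left)
next
  case False
  then show ?thesis
    using prime_elem_monic_linear is_unit_const[of b] by (metis lin_form_monic prime_elem_mult_unit_left)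
qed

text \<open>Modulo a linear form, both variables are scalar multiples of a single linear form \<open>t\<close>.\<close>

lemma lin_form_residue:
  fixes a b :: "'k::field"
  assumes "a \<noteq> 0 \<or> b \<noteq> 0"
  obtains t where "homogeneous 1 t"
    "\<And>d f. homogeneous d f \<Longrightarrow> \<exists>c. lin_form a b dvd f - [:[:c:]:] * t ^ d"
proof -
  \<comment> \<open>For \<open>b = 0\<close> the form is associated to \<open>x\<close>, so
    \<open>t\<close> is \<open>y\<close>; otherwise \<open>y\<close> is congruent to
    \<open>- (a / b) * x\<close> and \<open>t\<close> is \<open>x\<close>.\<close>
  obtain t r s where t: "homogeneous 1 t" "lin_form a b dvd var_x - [:[:r:]:] * t"
      "lin_form a b dvd var_y - [:[:s:]:] * t"
  proof (cases "b = 0")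
    case True
    have "lin_form a b dvd [:[:inverse a:]:] * lin_form a b"
      by (rule dvd_triv_right)
    also have "\<dots> = var_x - [:[:0:]:] * var_y"
      using True assms by (simp add: lin_form_def var_x_def)
    finally show ?thesis
      using that[of var_y 0 1] homogeneous_lin_form[of 0 1] by (simp add: lin_form_def var_y_def flip: one_pCons)
  next
    case False
    have "lin_form a b dvd [:[:inverse b:]:] * lin_form a b"
      by (rule dvd_triv_right)
    also have "\<dots> = var_y - [:[:- (a / b):]:] * var_x"
      using False by (simp add: lin_form_def var_x_def var_y_def field_simps)
    finally show ?thesis
      using that[of var_x 1 "- (a / b)"] homogeneous_lin_form[of 1 0] by (simp add: lin_form_def var_x_def flip: one_pCons)
  qed
  \<comment> \<open>\<open>E d f\<close> says that the residue of \<open>f\<close> is a scalar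
    multiple of \<open>t ^ d\<close>. It is stable under sums and products, so checking the
    variables and constants suffices.\<close>
  define E where "E d f \<longleftrightarrow> (\<exists>c. lin_form a b dvd f - [:[:c:]:] * t ^ d)" for d f
  have E_add: "E d (f + g)" if "E d f" "E d g" for d f g
  proof -
    from that obtain c c' where
      "lin_form a b dvd f - [:[:c:]:] * t ^ d" "lin_form a b dvd g - [:[:c':]:] * t ^ d"
      unfolding E_def by blast
    then have "lin_form a b dvd (f - [:[:c:]:] * t ^ d) + (g - [:[:c':]:] * t ^ d)"
      by (rule dvd_add)
    also have "\<dots> = f + g - ([:[:c:]:] + [:[:c':]:]) * t ^ d"
      by (simp only: algebra_simps)
    also have "[:[:c:]:] + [:[:c':]:] = [:[:c + c':]:]"
      by simp
    finally show ?thesis unfolding E_def by blast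
  qed
  have E_mult: "E (d + e) (f * g)" if "E d f" "E e g" for d e f g
  proof -
    from that obtain c c' where
      "lin_form a b dvd f - [:[:c:]:] * t ^ d" "lin_form a b dvd g - [:[:c':]:] * t ^ e"
      unfolding E_def by blast
    then have "lin_form a b dvd (f - [:[:c:]:] * t ^ d) * g + [:[:c:]:] * t ^ d * (g - [:[:c':]:] * t ^ e)"
      by (simp only: dvd_add dvd_mult dvd_mult2)
    also have "\<dots> = f * g - ([:[:c:]:] * [:[:c':]:]) * t ^ (d + e)"
      by (simp only: algebra_simps power_add)
    also have "[:[:c:]:] * [:[:c':]:] = [:[:c * c':]:]"
      by simp
    finally show ?thesis unfolding E_def by blast
  qed
  have E_x: "E 1 var_x" and E_y: "E 1 var_y"
    using t unfolding E_def by auto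
  have E_const: "E 0 [:[:c:]:]" for c
    unfolding E_def by (rule exI[of _ c]) simp
  have E_power: "E n (f ^ n)" if "E 1 f" for n f
  proof (induction n)
    case 0
    then show ?case using E_const[of 1] by (simp add: one_pCons)
  next
    case (Suc n)
    then show ?case using E_mult[OF that Suc] by simp
  qed
  have E_sum: "E d (\<Sum>i\<in>I. f i)" if "\<And>i. i \<in> I \<Longrightarrow> E d (f i)" "finite I" for d f and I :: "nat set"
    using that(2,1)
  proof (induction I)
    case empty
    have "E d 0" unfolding E_def by (rule exI[of _ 0]) simp
    then show ?case by simp
  qed (auto intro: E_add)
  have "E d f" if "homogeneous d f" for d f
  proof -
    have "f = (\<Sum>i\<le>d. monom (monom (coeff (coeff f i) (d - i)) (d - i)) i)"
      using hom_part_homogeneous[OF that] by (simp add: hom_part_def)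
    moreover have "E d (monom (monom c (d - i)) i)" if "i \<le> d" for i c
    proof -
      have "monom (monom c (d - i)) i = [:[:c:]:] * (var_x ^ (d - i) * var_y ^ i)"
        by (simp add: var_x_def var_y_def monom_altdef poly_const_pow)
      moreover have "E (0 + ((d - i) + i)) ([:[:c:]:] * (var_x ^ (d - i) * var_y ^ i))"
        by (intro E_mult E_const E_power E_x E_y)
      ultimately show ?thesis using that by simp
    qed
    ultimately show ?thesis
      using E_sum[of "{..d}" d] by (metis (no_types, lifting) atMost_iff finite_atMost)
  qed
  then show ?thesis
    using that[OF t(1)] unfolding E_def by blast
qed

text \<open>Homogeneous residues are scalar multiples of powers of \<open>t\<close>, so a nonzero
  residue of degree \<open>d\<close> divides every homogeneous residue of degree at least
  \<open>d\<close>.\<close>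

lemma lin_form_reduce:
  fixes a b :: "'k::field"
  assumes "a \<noteq> 0 \<or> b \<noteq> 0" "homogeneous d f" "homogeneous e g" "\<not> lin_form a b dvd f" "d \<le> e"
  obtains h where "homogeneous (e - d) h" "lin_form a b dvd g - h * f"
proof -
  obtain t where t: "homogeneous 1 t"
      "\<And>d f. homogeneous d f \<Longrightarrow> \<exists>c. lin_form a b dvd f - [:[:c:]:] * t ^ d"
    using lin_form_residue[OF assms(1)] by blast
  obtain c c' where c: "lin_form a b dvd f - [:[:c:]:] * t ^ d" "lin_form a b dvd g - [:[:c':]:] * t ^ e"
    using t(2) assms by meson
  have "c \<noteq> 0" using c(1) assms(4) by auto
  define h where "h = [:[:c' / c:]:] * t ^ (e - d)"
  have "homogeneous (0 + (e - d) * 1) h"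
    unfolding h_def by (intro homogeneous_mult homogeneous_const homogeneous_power t)
  then have 1: "homogeneous (e - d) h" by simp
  have "lin_form a b dvd (g - [:[:c':]:] * t ^ e) - h * (f - [:[:c:]:] * t ^ d)"
    by (intro dvd_diff dvd_mult c)
  also have "\<dots> = g - h * f - [:[:c':]:] * t ^ e + ([:[:c' / c:]:] * [:[:c:]:]) * (t ^ (e - d) * t ^ d)"
    unfolding h_def by (simp only: algebra_simps)
  also have "[:[:c' / c:]:] * [:[:c:]:] = [:[:c':]:]"
    using \<open>c \<noteq> 0\<close> by simp
  also have "t ^ (e - d) * t ^ d = t ^ e"
    using assms(5) by (simp flip: power_add)
  finally show ?thesis using that[OF 1] by simp
qed

section \<open>Logarithmic derivations\<close>

definition det :: "'k::field derivation \<Rightarrow> 'k derivation \<Rightarrow> 'k poly poly" where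
  "det \<delta> \<epsilon> = fst \<delta> * snd \<epsilon> - snd \<delta> * fst \<epsilon>"

lemma fst_der_scale [simp]: "fst (der_scale p \<delta>) = p * fst \<delta>"
  and snd_der_scale [simp]: "snd (der_scale p \<delta>) = p * snd \<delta>"
  by (simp_all add: der_scale_def)

lemma det_nonzero_imp: "det \<delta> \<epsilon> \<noteq> 0 \<Longrightarrow> \<delta> \<noteq> 0" "det \<delta> \<epsilon> \<noteq> 0 \<Longrightarrow> \<epsilon> \<noteq> 0"
  by (auto simp: det_def)

lemma det_swap: "det \<epsilon> \<delta> = - det \<delta> \<epsilon>"
  by (simp add: det_def)

lemma det_combination:
  "det (der_scale p \<delta> + der_scale q \<epsilon>) (der_scale r \<delta> + der_scale s \<epsilon>) = (p * s - q * r) * det \<delta> \<epsilon>"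
  by (simp add: det_def algebra_simps)

lemma det_homogeneous:
  "der_homogeneous d \<delta> \<Longrightarrow> der_homogeneous e \<epsilon> \<Longrightarrow> homogeneous (d + e) (det \<delta> \<epsilon>)"
  by (simp add: det_def der_homogeneous_def homogeneous_diff homogeneous_mult)

text \<open>If the determinant vanishes, its rows give two explicit relations, which are trivial
  only if both derivations are zero. The converse is Cramer's rule.\<close>

lemma S_independent_iff: "S_independent \<delta> \<epsilon> \<longleftrightarrow> det \<delta> \<epsilon> \<noteq> 0"
proof
  assume *: "S_independent \<delta> \<epsilon>"
  show "det \<delta> \<epsilon> \<noteq> 0"
  proof
    assume "det \<delta> \<epsilon> = 0"
    then have "der_scale (snd \<epsilon>) \<delta> + der_scale (- snd \<delta>) \<epsilon> = 0"
      "der_scale (fst \<epsilon>) \<delta> + der_scale (- fst \<delta>) \<epsilon> = 0"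
      by (simp_all add: det_def prod_eq_iff mult.commute)
    then have "snd \<epsilon> = 0 \<and> - snd \<delta> = 0" "fst \<epsilon> = 0 \<and> - fst \<delta> = 0"
      using * unfolding S_independent_def by blast+
    then have "\<delta> = 0" "\<epsilon> = 0"
      by (simp_all add: prod_eq_iff)
    then have "der_scale 1 \<delta> + der_scale 1 \<epsilon> = 0"
      by (simp add: prod_eq_iff)
    then show False
      using * unfolding S_independent_def by (metis zero_neq_one)
  qed
next
  assume *: "det \<delta> \<epsilon> \<noteq> 0"
  show "S_independent \<delta> \<epsilon>"
    unfolding S_independent_def
  proof (intro allI impI)
    fix p q assume "der_scale p \<delta> + der_scale q \<epsilon> = 0"
    then have 0: "p * fst \<delta> + q * fst \<epsilon> = 0" "p * snd \<delta> + q * snd \<epsilon> = 0"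
      by (auto simp: prod_eq_iff)
    have "p * det \<delta> \<epsilon> = (p * fst \<delta> + q * fst \<epsilon>) * snd \<epsilon> - (p * snd \<delta> + q * snd \<epsilon>) * fst \<epsilon>"
      "q * det \<delta> \<epsilon> = (p * snd \<delta> + q * snd \<epsilon>) * fst \<delta> - (p * fst \<delta> + q * fst \<epsilon>) * snd \<delta>"
      by (simp_all add: det_def algebra_simps)
    then show "p = 0 \<and> q = 0"
      using * unfolding 0 by simp
  qed
qed

text \<open>Three vectors in a plane satisfy a linear relation with their pairwise determinants as
  coefficients; a nonzero coordinate of \<open>\<epsilon>\<close> can then be cancelled.\<close>

lemma det_eq_0_trans:
  assumes "det \<delta> \<epsilon> = 0" "det \<epsilon> \<eta> = 0" "\<epsilon> \<noteq> 0"
  shows "det \<delta> \<eta> = 0"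
proof -
  have "fst \<epsilon> * det \<delta> \<eta> = fst \<delta> * det \<epsilon> \<eta> + fst \<eta> * det \<delta> \<epsilon>"
    "snd \<epsilon> * det \<delta> \<eta> = snd \<delta> * det \<epsilon> \<eta> + snd \<eta> * det \<delta> \<epsilon>"
    by (simp_all add: det_def algebra_simps)
  then show ?thesis
    using assms by (auto simp: prod_eq_iff)
qed

lemma der_apply_lin_form: "der_apply \<delta> (lin_form a b) = fst \<delta> * [:[:a:]:] + snd \<delta> * [:[:b:]:]"
proof -
  have "partial_x (lin_form a b) = [:[:a:]:]"
    by (simp add: partial_x_def lin_form_def map_poly_pCons pderiv_pCons)
  moreover have "partial_y (lin_form a b) = [:[:b:]:]"
    by (simp add: partial_y_def lin_form_def pderiv_pCons)
  ultimately show ?thesis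
    by (simp add: der_apply_def)
qed

lemma der_apply_diff: "der_apply (\<delta> - \<epsilon>) l = der_apply \<delta> l - der_apply \<epsilon> l"
  and der_apply_scale: "der_apply (der_scale p \<delta>) l = p * der_apply \<delta> l"
  by (simp_all add: der_apply_def algebra_simps)

lemma homogeneous_der_apply:
  assumes "der_homogeneous d \<delta>"
  shows "homogeneous d (der_apply \<delta> (lin_form a b))"
proof -
  have "homogeneous (d + 0) (fst \<delta> * [:[:a:]:] + snd \<delta> * [:[:b:]:])"
    using assms unfolding der_homogeneous_def
    by (intro homogeneous_add homogeneous_mult homogeneous_const) auto
  then show ?thesis
    by (simp add: der_apply_lin_form)
qed

lemma der_homogeneous_scale:
  "homogeneous e p \<Longrightarrow> der_homogeneous d \<delta> \<Longrightarrow> der_homogeneous (e + d) (der_scale p \<delta>)"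
  by (simp add: der_homogeneous_def homogeneous_mult)

lemma der_homogeneous_diff:
  "der_homogeneous d \<delta> \<Longrightarrow> der_homogeneous d \<epsilon> \<Longrightarrow> der_homogeneous d (\<delta> - \<epsilon>)"
  by (simp add: der_homogeneous_def homogeneous_diff)

lemma der_homogeneous_cancel:
  assumes "der_homogeneous n \<delta>" "der_homogeneous m (der_scale p \<delta>)" "der_scale p \<delta> \<noteq> 0"
  shows "n \<le> m" "homogeneous (m - n) p"
proof -
  from assms(3) have "p \<noteq> 0" "fst \<delta> \<noteq> 0 \<or> snd \<delta> \<noteq> 0"
    by (auto simp: prod_eq_iff)
  then have "n \<le> m \<and> homogeneous (m - n) p"
    using assms(1,2) homogeneous_cancel[of n "fst \<delta>" m p] homogeneous_cancel[of n "snd \<delta>" m p]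
    unfolding der_homogeneous_def by auto
  then show "n \<le> m" "homogeneous (m - n) p" by auto
qed

lemma homogeneous_basis_swap:
  "homogeneous_basis A \<alpha> \<mu> d1 d2 \<theta> \<theta>' \<Longrightarrow> homogeneous_basis A \<alpha> \<mu> d2 d1 \<theta>' \<theta>"
  unfolding homogeneous_basis_def S_independent_iff
  by (metis add.commute det_swap neg_equal_0_iff_equal)

abbreviation mult_inc :: "('h \<Rightarrow> nat) \<Rightarrow> 'h \<Rightarrow> 'h \<Rightarrow> nat" where
  "mult_inc \<mu> H \<equiv> \<mu>(H := Suc (\<mu> H))"

lemma mult_size_inc:
  assumes "finite A" "H \<in> A"
  shows "mult_size A (mult_inc \<mu> H) = Suc (mult_size A \<mu>)"
  using assms by (simp add: mult_size_def sum.remove[of A H])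

text \<open>The lines are represented by the coefficients of their defining forms. For nonzero
  linear forms, \<open>distinct\<close> says that they are pairwise non-proportional.\<close>

locale line_arrangement =
  fixes A :: "'h set" and a b :: "'h \<Rightarrow> 'k::field"
  assumes finite_A: "finite A"
    and nonzero: "H \<in> A \<Longrightarrow> a H \<noteq> 0 \<or> b H \<noteq> 0"
    and distinct: "H \<in> A \<Longrightarrow> K \<in> A \<Longrightarrow> H \<noteq> K \<Longrightarrow> \<not> lin_form (a H) (b H) dvd lin_form (a K) (b K)"
begin

abbreviation \<alpha> :: "'h \<Rightarrow> 'k poly poly" where
  "\<alpha> \<equiv> \<lambda>H. lin_form (a H) (b H)"

abbreviation D :: "('h \<Rightarrow> nat) \<Rightarrow> 'k derivation set" where
  "D \<mu> \<equiv> log_derivations A \<alpha> \<mu>"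

abbreviation is_basis where
  "is_basis \<mu> d1 d2 \<theta> \<theta>' \<equiv> homogeneous_basis A \<alpha> \<mu> d1 d2 \<theta> \<theta>'"

lemma prime_alpha: "H \<in> A \<Longrightarrow> prime_elem (\<alpha> H)"
  by (rule prime_elem_lin_form[OF nonzero])

lemma alpha_nonzero: "H \<in> A \<Longrightarrow> \<alpha> H \<noteq> 0"
  by (rule prime_elem_not_zeroI[OF prime_alpha])

lemma D_iff: "\<delta> \<in> D \<mu> \<longleftrightarrow> (\<forall>H\<in>A. \<alpha> H ^ \<mu> H dvd der_apply \<delta> (\<alpha> H))"
  by (simp add: log_derivations_def)

lemma D_diff: "\<delta> \<in> D \<mu> \<Longrightarrow> \<epsilon> \<in> D \<mu> \<Longrightarrow> \<delta> - \<epsilon> \<in> D \<mu>"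
  and D_scale: "\<delta> \<in> D \<mu> \<Longrightarrow> der_scale p \<delta> \<in> D \<mu>"
  by (auto simp: D_iff der_apply_diff der_apply_scale intro: dvd_diff dvd_mult)

lemma D_inc_iff:
  assumes "H \<in> A"
  shows "\<delta> \<in> D (mult_inc \<mu> H) \<longleftrightarrow> \<delta> \<in> D \<mu> \<and> \<alpha> H ^ Suc (\<mu> H) dvd der_apply \<delta> (\<alpha> H)"
  proof
  assume *: "\<delta> \<in> D (mult_inc \<mu> H)"
  then have "\<alpha> K ^ \<mu> K dvd der_apply \<delta> (\<alpha> K)" if "K \<in> A" for K
    using that power_le_dvd[of "\<alpha> K" "mult_inc \<mu> H K" _ "\<mu> K"] unfolding D_iff by simp
  with * assms show "\<delta> \<in> D \<mu> \<and> \<alpha> H ^ Suc (\<mu> H) dvd der_apply \<delta> (\<alpha> H)"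
    unfolding D_iff by (metis fun_upd_same)
qed (simp add: D_iff)

lemma D_incD: "H \<in> A \<Longrightarrow> \<delta> \<in> D (mult_inc \<mu> H) \<Longrightarrow> \<delta> \<in> D \<mu>"
  by (simp only: D_inc_iff)

text \<open>Only the order of vanishing at \<open>H\<close> is at stake:
  \<open>der_apply \<delta> (\<alpha> H)\<close> has it exactly \<open>\<mu> H\<close>, so the
  missing prime factor must come from \<open>u\<close>.\<close>

lemma scale_in_D_inc_imp_dvd:
  assumes "H \<in> A" "\<delta> \<in> D \<mu>" "\<delta> \<notin> D (mult_inc \<mu> H)" "der_scale u \<delta> \<in> D (mult_inc \<mu> H)"
  shows "\<alpha> H dvd u"
proof -
  from assms(1,2) obtain f where f: "der_apply \<delta> (\<alpha> H) = \<alpha> H ^ \<mu> H * f"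
    unfolding D_iff by blast
  have "\<not> \<alpha> H dvd f"
    using assms(1-3) by (auto simp: D_inc_iff f alpha_nonzero power_Suc2 simp del: power_Suc)
  moreover have "\<alpha> H ^ Suc (\<mu> H) dvd \<alpha> H ^ \<mu> H * (u * f)"
    using assms(1,4) by (simp add: D_inc_iff der_apply_scale f mult.left_commute del: power_Suc)
  then have "\<alpha> H dvd u * f"
    using assms(1) by (simp add: alpha_nonzero power_Suc2 del: power_Suc)
  ultimately show ?thesis
    using prime_alpha[OF assms(1)] by (simp add: prime_elem_dvd_mult_iff)
qed

lemma alpha_power_cancel:
  assumes "H \<in> A" "K \<in> A" "H \<noteq> K" "\<alpha> H ^ m dvd \<alpha> K ^ n * p"
  shows "\<alpha> H ^ m dvd p"
proof (cases "m = 0")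
  case False
  moreover have "\<not> \<alpha> H dvd \<alpha> K ^ n"
    using prime_elem_dvd_power[OF prime_alpha[OF assms(1)]] distinct[OF assms(1-3)] by blast
  ultimately show ?thesis
    using prime_power_dvd_multD[OF prime_alpha[OF assms(1)] assms(4)] by blast
qed simp

text \<open>The factor \<open>\<alpha> H\<close> supplies exactly the additional power at
  \<open>H\<close>; at any other line it is coprime to the power required there.\<close>

lemma scale_alpha_in_D_inc_iff:
  assumes "H \<in> A"
  shows "der_scale (\<alpha> H) \<delta> \<in> D (mult_inc \<mu> H) \<longleftrightarrow> \<delta> \<in> D \<mu>"
proof -
  have key: "\<alpha> K ^ mult_inc \<mu> H K dvd \<alpha> H * der_apply \<delta> (\<alpha> K) \<longleftrightarrow> \<alpha> K ^ \<mu> K dvd der_apply \<delta> (\<alpha> K)"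
    if "K \<in> A" for K
  proof (cases "K = H")
    case True
    then show ?thesis
      using alpha_nonzero[OF assms] by simp
  next
    case False
    then have "mult_inc \<mu> H K = \<mu> K"
      by simp
    then show ?thesis
      using alpha_power_cancel[OF that assms False, of "\<mu> K" 1] dvd_mult
      unfolding power_one_right by metis
  qed
  show ?thesis
    unfolding D_iff der_apply_scale by (rule ball_cong[OF refl key])
qed

section \<open>The defining polynomial and the degree bound\<close>

definition Q :: "('h \<Rightarrow> nat) \<Rightarrow> 'k poly poly" where
  "Q \<mu> = (\<Prod>H\<in>A. \<alpha> H ^ \<mu> H)"

lemma homogeneous_Q: "homogeneous (mult_size A \<mu>) (Q \<mu>)"
  unfolding Q_def mult_size_def
proof (rule homogeneous_prod[OF finite_A])
  show "homogeneous (\<mu> H) (\<alpha> H ^ \<mu> H)" for H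
    using homogeneous_power[OF homogeneous_lin_form, of "\<mu> H"] by simp
qed

text \<open>Powers of non-associated primes divide independently: once the product over
  \<open>B\<close> is split off, the power at a further line must divide the cofactor.\<close>

lemma Q_dvdI:
  assumes "\<And>H. H \<in> A \<Longrightarrow> \<alpha> H ^ \<mu> H dvd p"
  shows "Q \<mu> dvd p"
proof -
  have cancel: "\<alpha> H ^ m dvd r"
    if "finite B" "H \<in> A" "B \<subseteq> A" "H \<notin> B" "\<alpha> H ^ m dvd (\<Prod>K\<in>B. \<alpha> K ^ \<mu> K) * r" for B H m r
    using that
  proof (induction B arbitrary: r)
    case (insert K B)
    have "(\<Prod>K\<in>insert K B. \<alpha> K ^ \<mu> K) * r = (\<Prod>K\<in>B. \<alpha> K ^ \<mu> K) * (\<alpha> K ^ \<mu> K * r)"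
      by (simp only: prod.insert[OF insert(1,2)] mult_ac)
    with insert(7) have dvd: "\<alpha> H ^ m dvd (\<Prod>K\<in>B. \<alpha> K ^ \<mu> K) * (\<alpha> K ^ \<mu> K * r)"
      by metis
    have B: "K \<in> A" "B \<subseteq> A" "H \<notin> B" "H \<noteq> K"
      using insert(5,6) by blast+
    show ?case
      using insert(3)[OF insert(4) B(2,3) dvd] by (rule alpha_power_cancel[OF insert(4) B(1,4)])
  qed simp
  have "(\<Prod>H\<in>B. \<alpha> H ^ \<mu> H) dvd p" if "finite B" "B \<subseteq> A" for B
    using that
  proof (induction B)
    case (insert H B)
    have H: "H \<in> A" "B \<subseteq> A"
      using insert(4) by blast+
    obtain r where r: "p = (\<Prod>H\<in>B. \<alpha> H ^ \<mu> H) * r"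
      using insert(3)[OF H(2)] by (rule dvdE)
    have "\<alpha> H ^ \<mu> H dvd (\<Prod>H\<in>B. \<alpha> H ^ \<mu> H) * r"
      using assms[OF H(1)] unfolding r .
    then have "\<alpha> H ^ \<mu> H dvd r"
      by (rule cancel[OF insert(1) H insert(2)])
    then show ?case
      unfolding r prod.insert[OF insert(1,2)] mult.commute[of "\<alpha> H ^ \<mu> H"]
      by (rule mult_dvd_mono[OF dvd_refl])
  qed simp
  then show ?thesis
    unfolding Q_def using finite_A by blast
qed

text \<open>Both \<open>a H\<close> and \<open>b H\<close> times the determinant are combinations of
  the values of the derivations at \<open>\<alpha> H\<close>, and one of these two scalars is a
  unit.\<close>

lemma Q_dvd_det:
  assumes "\<delta> \<in> D \<mu>" "\<epsilon> \<in> D \<mu>"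
  shows "Q \<mu> dvd det \<delta> \<epsilon>"
proof (rule Q_dvdI)
  fix H assume H: "H \<in> A"
  let ?a = "[:[:a H:]:]" and ?b = "[:[:b H:]:]"
  have "\<alpha> H ^ \<mu> H dvd der_apply \<delta> (\<alpha> H) * snd \<epsilon> - der_apply \<epsilon> (\<alpha> H) * snd \<delta>"
    "\<alpha> H ^ \<mu> H dvd der_apply \<epsilon> (\<alpha> H) * fst \<delta> - der_apply \<delta> (\<alpha> H) * fst \<epsilon>"
    using assms H unfolding D_iff by (simp_all only: dvd_diff dvd_mult2)
  moreover have "der_apply \<delta> (\<alpha> H) * snd \<epsilon> - der_apply \<epsilon> (\<alpha> H) * snd \<delta> = ?a * det \<delta> \<epsilon>"
    "der_apply \<epsilon> (\<alpha> H) * fst \<delta> - der_apply \<delta> (\<alpha> H) * fst \<epsilon> = ?b * det \<delta> \<epsilon>"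
    unfolding der_apply_lin_form det_def by (simp_all only: algebra_simps)
  ultimately have "\<alpha> H ^ \<mu> H dvd ?a * det \<delta> \<epsilon>" "\<alpha> H ^ \<mu> H dvd ?b * det \<delta> \<epsilon>"
    by simp_all
  then show "\<alpha> H ^ \<mu> H dvd det \<delta> \<epsilon>"
    using nonzero[OF H] is_unit_const dvd_mult_unit_iff' by blast
qed

text \<open>A nonzero multiple of \<open>Q \<mu>\<close> has degree at least
  \<open>mult_size A \<mu>\<close>. The bound serves both to construct bases and to prove dependence
  of neighbours.\<close>

lemma det_eq_0_of_degree_less:
  assumes "\<delta> \<in> D \<mu>" "\<epsilon> \<in> D \<mu>" "der_homogeneous d \<delta>" "der_homogeneous e \<epsilon>" "d + e < mult_size A \<mu>"
  shows "det \<delta> \<epsilon> = 0"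
proof (rule ccontr)
  assume *: "det \<delta> \<epsilon> \<noteq> 0"
  obtain r where r: "det \<delta> \<epsilon> = r * Q \<mu>"
    using Q_dvd_det[OF assms(1,2)] by (metis dvdE mult.commute)
  then have "mult_size A \<mu> \<le> d + e"
    using * homogeneous_cancel(1)[OF homogeneous_Q[of \<mu>], of "d + e" r] det_homogeneous[OF assms(3,4)]
    by auto
  with assms(5) show False by simp
qed

section \<open>Homogeneous bases and their degrees\<close>

lemma is_basisD:
  assumes "is_basis \<mu> d1 d2 \<theta> \<theta>'"
  shows "\<theta> \<in> D \<mu>" "\<theta>' \<in> D \<mu>" "der_homogeneous d1 \<theta>" "der_homogeneous d2 \<theta>'" "det \<theta> \<theta>' \<noteq> 0"
    "\<And>\<delta>. \<delta> \<in> D \<mu> \<Longrightarrow> \<exists>p q. \<delta> = der_scale p \<theta> + der_scale q \<theta>'"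
  using assms by (auto simp: homogeneous_basis_def S_independent_iff)

text \<open>An elementary base change preserves the determinant, and the degree of \<open>h\<close>
  is the one that keeps the second generator homogeneous.\<close>

lemma is_basis_shear:
  assumes "is_basis \<mu> d1 d2 \<theta> \<theta>'" "d1 \<le> d2" "homogeneous (d2 - d1) h"
  shows "is_basis \<mu> d1 d2 \<theta> (\<theta>' - der_scale h \<theta>)"
proof -
  note B = is_basisD[OF assms(1)]
  have "der_homogeneous d2 (der_scale h \<theta>)"
    using der_homogeneous_scale[OF assms(3) B(3)] assms(2) by simp
  moreover have "det \<theta> (\<theta>' - der_scale h \<theta>) = det \<theta> \<theta>'"
    by (simp add: det_def algebra_simps)
  moreover have "\<exists>p q. \<delta> = der_scale p \<theta> + der_scale q (\<theta>' - der_scale h \<theta>)" if \<delta>: "\<delta> \<in> D \<mu>" for \<delta>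
  proof -
    obtain p q where "\<delta> = der_scale p \<theta> + der_scale q \<theta>'"
      using B(6)[OF \<delta>] by blast
    then have "\<delta> = der_scale (p + q * h) \<theta> + der_scale q (\<theta>' - der_scale h \<theta>)"
      by (simp add: prod_eq_iff algebra_simps)
    then show ?thesis by blast
  qed
  ultimately show ?thesis
    using B unfolding homogeneous_basis_def S_independent_iff
    by (simp add: D_diff D_scale der_homogeneous_diff)
qed

lemma is_basis_scale:
  assumes "is_basis \<mu> d1 d2 \<theta> \<theta>'" "d1 + d2 = mult_size A \<mu>" "H \<in> A" "\<theta> \<in> D (mult_inc \<mu> H)"
  shows "is_basis (mult_inc \<mu> H) d1 (Suc d2) \<theta> (der_scale (\<alpha> H) \<theta>')"
proof -
  note B = is_basisD[OF assms(1)]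
  \<comment> \<open>Otherwise both generators lie in the smaller module, where their determinant has
    degree \<open>mult_size A \<mu>\<close>, one below the bound, and so vanishes.\<close>
  have notin: "\<theta>' \<notin> D (mult_inc \<mu> H)"
    using det_eq_0_of_degree_less[OF assms(4) _ B(3,4)] assms B(5) by (auto simp: mult_size_inc finite_A)
  have "\<exists>p q. \<delta> = der_scale p \<theta> + der_scale q (der_scale (\<alpha> H) \<theta>')" if \<delta>: "\<delta> \<in> D (mult_inc \<mu> H)" for \<delta>
  proof -
    obtain p q where pq: "\<delta> = der_scale p \<theta> + der_scale q \<theta>'"
      using B(6) D_incD assms(3) \<delta> by blast
    have "der_scale q \<theta>' = \<delta> - der_scale p \<theta>"
      using pq by simp
    then have "der_scale q \<theta>' \<in> D (mult_inc \<mu> H)"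
      using D_diff[OF \<delta> D_scale[OF assms(4)]] by simp
    then obtain r where "q = \<alpha> H * r"
      using scale_in_D_inc_imp_dvd[OF assms(3) B(2) notin] by blast
    then have "\<delta> = der_scale p \<theta> + der_scale r (der_scale (\<alpha> H) \<theta>')"
      using pq by (simp add: prod_eq_iff mult_ac)
    then show ?thesis by blast
  qed
  moreover have "det \<theta> (der_scale (\<alpha> H) \<theta>') = \<alpha> H * det \<theta> \<theta>'"
    by (simp add: det_def algebra_simps)
  moreover have "der_homogeneous (Suc d2) (der_scale (\<alpha> H) \<theta>')"
    using der_homogeneous_scale[OF homogeneous_lin_form B(4)] by simp
  ultimately show ?thesis
    using B assms(3,4) unfolding homogeneous_basis_def S_independent_iff
    by (simp add: scale_alpha_in_D_inc_iff alpha_nonzero)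
qed

text \<open>
  If neither basis element already lies in the smaller module, subtracting a multiple of the one
  of lower degree from the other one produces an element that does.
\<close>

lemma is_basis_inc:
  assumes "is_basis \<mu> d1 d2 \<theta> \<theta>'" "d1 + d2 = mult_size A \<mu>" "H \<in> A" "d1 \<le> d2"
  shows "\<exists>e1 e2 \<eta> \<eta>'. is_basis (mult_inc \<mu> H) e1 e2 \<eta> \<eta>' \<and> e1 + e2 = mult_size A (mult_inc \<mu> H)"
proof -
  note B = is_basisD[OF assms(1)]
  have size: "Suc (d1 + d2) = mult_size A (mult_inc \<mu> H)"
    using assms by (simp add: mult_size_inc finite_A)
  have first: ?thesis if "\<theta> \<in> D (mult_inc \<mu> H)"
    using is_basis_scale[OF assms(1-3) that] size by (metis add_Suc_right)
  have second: ?thesis if "is_basis \<mu> d1 d2 \<theta> \<epsilon>" "\<epsilon> \<in> D (mult_inc \<mu> H)" for \<epsilon>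
    using is_basis_scale[OF homogeneous_basis_swap[OF that(1)] _ assms(3) that(2)] assms(2) size
    by (metis add.commute add_Suc_right)
  show ?thesis
  proof (cases "\<theta> \<in> D (mult_inc \<mu> H) \<or> \<theta>' \<in> D (mult_inc \<mu> H)")
    case True
    then show ?thesis
      using first second assms(1) by blast
  next
    case False
    obtain f g where fg: "der_apply \<theta> (\<alpha> H) = f * \<alpha> H ^ \<mu> H" "der_apply \<theta>' (\<alpha> H) = g * \<alpha> H ^ \<mu> H"
      using B(1,2) assms(3) unfolding D_iff by (metis dvdE mult.commute)
    have nz: "\<alpha> H ^ \<mu> H \<noteq> 0"
      using assms(3) alpha_nonzero by simp
    have ndvd: "\<not> \<alpha> H dvd f" "\<not> \<alpha> H dvd g"
      using False B(1,2) nz assms(3) by (auto simp: D_inc_iff fg)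
    have hom: "homogeneous (\<mu> H) (\<alpha> H ^ \<mu> H)"
      using homogeneous_power[OF homogeneous_lin_form, of "\<mu> H"] by simp
    have f: "\<mu> H \<le> d1" "homogeneous (d1 - \<mu> H) f"
      using homogeneous_cancel[OF hom nz, of d1 f] homogeneous_der_apply[OF B(3)] fg(1) ndvd(1)
      by (metis dvd_0_right)+
    have g: "homogeneous (d2 - \<mu> H) g"
      using homogeneous_cancel[OF hom nz, of d2 g] homogeneous_der_apply[OF B(4)] fg(2) ndvd(2)
      by (metis dvd_0_right)
    \<comment> \<open>Dividing out \<open>\<alpha> H ^ \<mu> H\<close> lowers both degrees by
      \<open>\<mu> H\<close>, so \<open>h\<close> still has degree \<open>d2 - d1\<close>, as the
      shear requires.\<close>
    obtain h where h: "homogeneous (d2 - \<mu> H - (d1 - \<mu> H)) h" "\<alpha> H dvd g - h * f"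
      using lin_form_reduce[OF nonzero[OF assms(3)] f(2) g ndvd(1) diff_le_mono[OF assms(4)]] by blast
    have "der_apply (\<theta>' - der_scale h \<theta>) (\<alpha> H) = (g - h * f) * \<alpha> H ^ \<mu> H"
      by (simp add: der_apply_diff der_apply_scale fg algebra_simps)
    then have "\<theta>' - der_scale h \<theta> \<in> D (mult_inc \<mu> H)"
      using h(2) B(1,2) assms(3) by (simp add: D_inc_iff D_diff D_scale mult_dvd_mono)
    moreover have "is_basis \<mu> d1 d2 \<theta> (\<theta>' - der_scale h \<theta>)"
      using is_basis_shear[OF assms(1,4)] h(1) f(1) by simp
    ultimately show ?thesis
      using second by blast
  qed
qed

text \<open>Freeness is obtained by raising one multiplicity at a time from zero. The degree sum is
  carried along because the inductive step relies on it.\<close>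

lemma is_basis_exists:
  "\<exists>d1 d2 \<theta> \<theta>'. is_basis \<mu> d1 d2 \<theta> \<theta>' \<and> d1 + d2 = mult_size A \<mu>"
proof (induction "mult_size A \<mu>" arbitrary: \<mu>)
  case 0
  have D: "\<delta> \<in> D \<mu>" for \<delta>
    using 0 finite_A by (simp add: D_iff mult_size_def)
  have "\<delta> = der_scale (fst \<delta>) (1, 0) + der_scale (snd \<delta>) (0, 1)" for \<delta> :: "'k derivation"
    by (simp add: prod_eq_iff)
  moreover have "homogeneous 0 (1 :: 'k poly poly)"
    using homogeneous_const[of 1] by (simp add: one_pCons)
  \<comment> \<open>With all multiplicities zero every derivation is logarithmic, and the two
    partial derivatives form a basis.\<close>
  ultimately have "is_basis \<mu> 0 0 (1, 0) (0, 1)"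
    unfolding homogeneous_basis_def S_independent_iff
    by (auto simp: D det_def der_homogeneous_def)
  then show ?case
    using 0 by (metis add_0)
next
  case (Suc n)
  then obtain H where H: "H \<in> A" "\<mu> H \<noteq> 0"
    unfolding mult_size_def by (metis nat.distinct(1) sum.neutral)
  define \<kappa> where "\<kappa> = \<mu>(H := \<mu> H - 1)"
  have \<mu>: "\<mu> = mult_inc \<kappa> H"
    using H by (auto simp: \<kappa>_def)
  then have "n = mult_size A \<kappa>"
    using Suc(2) mult_size_inc[OF finite_A H(1), of \<kappa>] by simp
  then obtain d1 d2 \<theta> \<theta>' where B: "is_basis \<kappa> d1 d2 \<theta> \<theta>'" "d1 + d2 = mult_size A \<kappa>"
    using Suc(1) by blast
  show ?case
    unfolding \<mu>
    \<comment> \<open>The inductive step expects the generator of smaller degree first, hence the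
      swapped basis as an alternative.\<close>
    using is_basis_inc[OF B H(1)] is_basis_inc[OF homogeneous_basis_swap[OF B(1)] _ H(1)] B(2)
    by (metis add.commute nle_le)
qed

text \<open>The determinant of the second basis is that of the first times the determinant of the
  base change. By symmetry the degree sum is an invariant of the module.\<close>

lemma is_basis_degrees_le:
  assumes "is_basis \<mu> d1 d2 \<theta> \<theta>'" "is_basis \<mu> e1 e2 \<eta> \<eta>'"
  shows "d1 + d2 \<le> e1 + e2"
proof -
  note B = is_basisD[OF assms(1)] and C = is_basisD[OF assms(2)]
  obtain p q r s where "\<eta> = der_scale p \<theta> + der_scale q \<theta>'" "\<eta>' = der_scale r \<theta> + der_scale s \<theta>'"
    using B(6) C(1,2) by meson
  then have "det \<eta> \<eta>' = (p * s - q * r) * det \<theta> \<theta>'"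
    by (simp only: det_combination)
  with C(5) det_homogeneous[OF C(3,4)] show ?thesis
    using homogeneous_cancel(1)[OF det_homogeneous[OF B(3,4)] B(5), of "e1 + e2" "p * s - q * r"] by auto
qed

lemma is_basis_degrees_sum:
  assumes "is_basis \<mu> d1 d2 \<theta> \<theta>'"
  shows "d1 + d2 = mult_size A \<mu>"
  using is_basis_exists[of \<mu>] is_basis_degrees_le assms by (metis le_antisym)

text \<open>A combination of two generators has no components below both of their degrees.\<close>

lemma is_basis_min_degree:
  assumes "is_basis \<mu> d1 d2 \<theta> \<theta>'" "\<delta> \<in> D \<mu>" "\<delta> \<noteq> 0" "der_homogeneous d \<delta>"
  shows "min d1 d2 \<le> d"
proof (rule ccontr)
  assume *: "\<not> min d1 d2 \<le> d"
  note B = is_basisD[OF assms(1)]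
  obtain p q where pq: "\<delta> = der_scale p \<theta> + der_scale q \<theta>'"
    using B(6) assms(2) by blast
  have "hom_part d (fst \<delta>) = 0" "hom_part d (snd \<delta>) = 0"
    using * B(3,4) by (auto simp: pq hom_part_add der_homogeneous_def hom_part_mult_less)
  then show False
    using assms(3,4) by (simp add: hom_part_homogeneous der_homogeneous_def prod_eq_iff)
qed

text \<open>The smaller degree is the least degree of a nonzero homogeneous element, and the sum of
  the degrees is \<open>mult_size A \<mu>\<close>. Both are independent of the basis, so the
  description defining \<open>exp_diff\<close> is unique.\<close>

lemma exp_diff_eq:
  assumes "is_basis \<mu> d1 d2 \<theta> \<theta>'"
  shows "exp_diff A \<alpha> \<mu> = nat \<bar>int d1 - int d2\<bar>"
  unfolding exp_diff_def
proof (rule the_equality)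
  fix n
  assume "\<exists>e1 e2 \<eta> \<eta>'. is_basis \<mu> e1 e2 \<eta> \<eta>' \<and> n = nat \<bar>int e1 - int e2\<bar>"
  then obtain e1 e2 \<eta> \<eta>' where C: "is_basis \<mu> e1 e2 \<eta> \<eta>'" and n: "n = nat \<bar>int e1 - int e2\<bar>"
    by blast
  have le: "min d1 d2 \<le> min e1 e2"
    if "is_basis \<mu> d1 d2 \<theta> \<theta>'" "is_basis \<mu> e1 e2 \<eta> \<eta>'" for d1 d2 e1 e2 \<theta> \<theta>' \<eta> \<eta>'
    using is_basis_min_degree[OF that(1)] is_basisD[OF that(2)] det_nonzero_imp
    by (metis min_def)
  have "min d1 d2 = min e1 e2"
    by (rule le_antisym[OF le[OF assms C] le[OF C assms]])
  moreover have "d1 + d2 = e1 + e2"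
    using assms C by (simp add: is_basis_degrees_sum)
  ultimately show "n = nat \<bar>int d1 - int d2\<bar>"
    unfolding n by linarith
qed (use assms in blast)

text \<open>
  Unbalanced multiplicities are detected by a single derivation, without reference to bases.
\<close>

definition low :: "('h \<Rightarrow> nat) \<Rightarrow> 'k derivation \<Rightarrow> nat \<Rightarrow> bool" where
  "low \<mu> \<delta> d \<longleftrightarrow> \<delta> \<in> D \<mu> \<and> \<delta> \<noteq> 0 \<and> der_homogeneous d \<delta> \<and> 2 * d < mult_size A \<mu>"

text \<open>The degrees add up to \<open>mult_size A \<mu>\<close>, so they differ exactly when the
  smaller one is below half of it.\<close>

lemma exp_diff_pos_iff: "exp_diff A \<alpha> \<mu> > 0 \<longleftrightarrow> (\<exists>\<delta> d. low \<mu> \<delta> d)"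
proof -
  obtain d1 d2 \<theta> \<theta>' where B: "is_basis \<mu> d1 d2 \<theta> \<theta>'" "d1 + d2 = mult_size A \<mu>"
    using is_basis_exists by blast
  note B' = is_basisD[OF B(1)]
  have "exp_diff A \<alpha> \<mu> > 0 \<longleftrightarrow> d1 < d2 \<or> d2 < d1"
    using exp_diff_eq[OF B(1)] by linarith
  also have "\<dots> \<longleftrightarrow> (\<exists>\<delta> d. low \<mu> \<delta> d)"
  proof
    assume "d1 < d2 \<or> d2 < d1"
    then have "low \<mu> \<theta> d1 \<or> low \<mu> \<theta>' d2"
      using B'(1-4) B(2) det_nonzero_imp[OF B'(5)] unfolding low_def by auto
    then show "\<exists>\<delta> d. low \<mu> \<delta> d" by blast
  next
    assume "\<exists>\<delta> d. low \<mu> \<delta> d"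
    then obtain \<delta> d where "low \<mu> \<delta> d" by blast
    then show "d1 < d2 \<or> d2 < d1"
      using is_basis_min_degree[OF B(1), of \<delta> d] B(2) unfolding low_def by auto
  qed
  finally show ?thesis .
qed

section \<open>Dependence and independence of nearby lower basis elements\<close>

lemma lower_basis_element_low:
  assumes "is_lower_basis_element A \<alpha> \<mu> \<theta>"
  obtains d where "low \<mu> \<theta> d"
proof -
  from assms obtain d1 d2 \<theta>' where B: "is_basis \<mu> d1 d2 \<theta> \<theta>'" "d1 < d2"
    unfolding is_lower_basis_element_def by blast
  then have "low \<mu> \<theta> d1"
    using is_basisD(1,3)[OF B(1)] det_nonzero_imp(1)[OF is_basisD(5)[OF B(1)]] is_basis_degrees_sum[OF B(1)]
    unfolding low_def by simp
  then show ?thesis by (rule that)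
qed

text \<open>Dependence alone gives a relation with coefficients on both sides. Since
  \<open>\<theta>\<close> belongs to a basis, the coefficient of the other generator must vanish,
  leaving a genuine multiple.\<close>

lemma lower_basis_element_multiple:
  assumes "is_lower_basis_element A \<alpha> \<mu> \<theta>" "\<delta> \<in> D \<mu>" "det \<theta> \<delta> = 0"
  obtains u where "\<delta> = der_scale u \<theta>"
proof -
  from assms(1) obtain d1 d2 \<theta>' where B: "is_basis \<mu> d1 d2 \<theta> \<theta>'"
    unfolding is_lower_basis_element_def by blast
  obtain p q where pq: "\<delta> = der_scale p \<theta> + der_scale q \<theta>'"
    using is_basisD(6)[OF B assms(2)] by blast
  then have "q * det \<theta> \<theta>' = 0"
    using assms(3) by (simp add: det_def algebra_simps)
  then have "q = 0"
    using is_basisD(5)[OF B] by simp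
  then have "\<delta> = der_scale p \<theta>"
    using pq by (simp add: prod_eq_iff)
  then show ?thesis by (rule that)
qed

text \<open>Both derivations lie in \<open>D \<mu>\<close>; from
  \<open>2 * d < mult_size A \<mu>\<close> and \<open>2 * e \<le> mult_size A \<mu>\<close> follows
  \<open>d + e < mult_size A \<mu>\<close>.\<close>

lemma low_inc_dependent:
  assumes "H \<in> A" "low \<mu> \<delta> d" "low (mult_inc \<mu> H) \<epsilon> e"
  shows "det \<delta> \<epsilon> = 0"
  using assms det_eq_0_of_degree_less[of \<delta> \<mu> \<epsilon> d e] D_incD[of H \<epsilon> \<mu>]
  by (simp add: low_def mult_size_inc finite_A)

text \<open>
  A dependent pair would satisfy \<open>\<theta>' = u \<theta>\<close> with \<open>u\<close> divisible by \<open>\<alpha> H * \<alpha> K\<close>, which makes the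
  degree of \<open>\<theta>'\<close> too large.
\<close>

lemma independent_chain:
  assumes "H \<in> A" "K \<in> A"
    and \<theta>: "is_lower_basis_element A \<alpha> \<mu> \<theta>"
    and \<theta>': "low (mult_inc (mult_inc \<mu> H) K) \<theta>' d'"
    and H: "\<And>\<delta> d. \<not> low (mult_inc \<mu> H) \<delta> d" and K: "\<And>\<delta> d. \<not> low (mult_inc \<mu> K) \<delta> d"
  shows "det \<theta> \<theta>' \<noteq> 0"
proof
  assume dep: "det \<theta> \<theta>' = 0"
  obtain d where d: "low \<mu> \<theta> d"
    using \<theta> by (rule lower_basis_element_low)
  note size = mult_size_inc[OF finite_A assms(1)] mult_size_inc[OF finite_A assms(2)]
  have \<theta>'_H: "\<theta>' \<in> D (mult_inc \<mu> H)"
    using \<theta>' D_incD[OF assms(2)] unfolding low_def by blast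
  then obtain u where u: "\<theta>' = der_scale u \<theta>"
    using lower_basis_element_multiple[OF \<theta> _ dep] D_incD[OF assms(1)] by blast
  \<comment> \<open>Raising a multiplicity only relaxes the degree condition, so
    \<open>\<theta>\<close> would be low in either module if it belonged to it.\<close>
  have notin: "\<theta> \<notin> D (mult_inc \<mu> H)" "\<theta> \<notin> D (mult_inc \<mu> K)"
    using d H[of \<theta> d] K[of \<theta> d] unfolding low_def size by auto
  then obtain w where w: "u = \<alpha> H * w"
    using scale_in_D_inc_imp_dvd[OF assms(1)] d \<theta>'_H unfolding low_def u by blast
  define \<rho> where "\<rho> = der_scale (\<alpha> H) \<theta>"
  have \<theta>'_eq: "\<theta>' = der_scale w \<rho>"
    using u w by (simp add: prod_eq_iff \<rho>_def mult_ac)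
  have \<rho>: "\<rho> \<in> D (mult_inc \<mu> H)" "\<rho> \<noteq> 0" "der_homogeneous (Suc d) \<rho>"
    using d der_homogeneous_scale[OF homogeneous_lin_form, of d \<theta>] alpha_nonzero[OF assms(1)] assms(1)
    by (auto simp: \<rho>_def low_def scale_alpha_in_D_inc_iff prod_eq_iff)
  \<comment> \<open>Exchanging the increments reduces membership of \<open>\<rho>\<close> to that of
    \<open>\<theta>\<close> in \<open>D (mult_inc \<mu> K)\<close>. The case \<open>H = K\<close>, a
    double step at one line, is included.\<close>
  have "mult_inc (mult_inc \<mu> H) K = mult_inc (mult_inc \<mu> K) H"
    by (auto simp: fun_upd_def)
  then have "\<rho> \<notin> D (mult_inc (mult_inc \<mu> H) K)"
    using notin(2) by (simp only: \<rho>_def scale_alpha_in_D_inc_iff assms(1) not_False_eq_True)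
  then obtain v where "w = \<alpha> K * v"
    using scale_in_D_inc_imp_dvd[OF assms(2) \<rho>(1)] \<theta>' unfolding low_def \<theta>'_eq by blast
  then have "\<theta>' = der_scale v (der_scale (\<alpha> K) \<rho>)"
    using \<theta>'_eq by (simp add: prod_eq_iff mult_ac)
  moreover have "der_homogeneous (Suc (Suc d)) (der_scale (\<alpha> K) \<rho>)"
    using der_homogeneous_scale[OF homogeneous_lin_form \<rho>(3)] by simp
  ultimately have "Suc (Suc d) \<le> d'"
    using der_homogeneous_cancel(1) \<theta>' unfolding low_def by blast
  \<comment> \<open>As \<open>\<rho>\<close> is not low,
    \<open>mult_size A \<mu> + 1 \<le> 2 * d + 2\<close>; hence
    \<open>2 * d' \<ge> 2 * d + 4 \<ge> mult_size A \<mu> + 3\<close>, too large for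
    \<open>\<theta>'\<close>.\<close>
  moreover have "mult_size A (mult_inc \<mu> H) \<le> 2 * Suc d"
    using H[of \<rho> "Suc d"] \<rho> unfolding low_def by auto
  ultimately show False
    using \<theta>' unfolding low_def size by simp
qed

text \<open>
  A dependent pair would satisfy \<open>\<alpha> K \<theta>' = u \<theta>\<close>. Since \<open>\<alpha> K\<close> is prime, either \<open>\<theta>'\<close> is a multiple
  of \<open>\<theta>\<close> and lies in the module of the join, or \<open>\<theta> / \<alpha> K\<close> lies in the module of the meet.
\<close>

lemma independent_antichain:
  assumes "H \<in> A" "K \<in> A" "H \<noteq> K"
    and \<theta>: "is_lower_basis_element A \<alpha> (mult_inc \<mu> K) \<theta>"
    and \<theta>': "low (mult_inc \<mu> H) \<theta>' d'"
    and meet: "\<And>\<delta> d. \<not> low \<mu> \<delta> d" and join: "\<And>\<delta> d. \<not> low (mult_inc (mult_inc \<mu> H) K) \<delta> d"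
  shows "det \<theta> \<theta>' \<noteq> 0"
proof
  assume dep: "det \<theta> \<theta>' = 0"
  obtain d where d: "low (mult_inc \<mu> K) \<theta> d"
    using \<theta> by (rule lower_basis_element_low)
  note size = mult_size_inc[OF finite_A assms(1)] mult_size_inc[OF finite_A assms(2)]
  \<comment> \<open>Multiplication by \<open>\<alpha> K\<close> moves \<open>\<theta>'\<close> into
    the module of the join, hence into that of \<open>mult_inc \<mu> K\<close>, where
    \<open>\<theta>\<close> is part of a basis.\<close>
  have "der_scale (\<alpha> K) \<theta>' \<in> D (mult_inc (mult_inc \<mu> H) K)"
    using \<theta>' by (simp only: scale_alpha_in_D_inc_iff[OF assms(2)] low_def)
  moreover have "mult_inc (mult_inc \<mu> H) K = mult_inc (mult_inc \<mu> K) H"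
    using assms(3) by (auto simp: fun_upd_def)
  ultimately have D: "der_scale (\<alpha> K) \<theta>' \<in> D (mult_inc \<mu> K)"
    using D_incD[OF assms(1), of _ "mult_inc \<mu> K"] by (simp only:)
  have "det \<theta> (der_scale (\<alpha> K) \<theta>') = \<alpha> K * det \<theta> \<theta>'"
    by (simp add: det_def algebra_simps)
  then have "det \<theta> (der_scale (\<alpha> K) \<theta>') = 0"
    using dep by simp
  then obtain u where u: "der_scale (\<alpha> K) \<theta>' = der_scale u \<theta>"
    using lower_basis_element_multiple[OF \<theta> D] by blast
  then have u': "\<alpha> K * fst \<theta>' = u * fst \<theta>" "\<alpha> K * snd \<theta>' = u * snd \<theta>"
    by (auto simp: prod_eq_iff)
  show False
  proof (cases "\<alpha> K dvd u")
    case True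
    then obtain w where "u = \<alpha> K * w" by blast
    then have "\<theta>' = der_scale w \<theta>"
      using u' alpha_nonzero[OF assms(2)] by (simp add: prod_eq_iff mult.assoc)
    then have "\<theta>' \<in> D (mult_inc \<mu> K)"
      using D_scale d unfolding low_def by blast
    then have "\<theta>' \<in> D (mult_inc (mult_inc \<mu> H) K)"
      using \<theta>' assms(3) D_inc_iff[OF assms(2), of \<theta>' "mult_inc \<mu> H"] D_inc_iff[OF assms(2), of \<theta>' \<mu>]
      unfolding low_def by simp
    then have "low (mult_inc (mult_inc \<mu> H) K) \<theta>' d'"
      using \<theta>' unfolding low_def size by simp
    then show False using join by blast
  next
    case False
    then have "\<alpha> K dvd fst \<theta>" "\<alpha> K dvd snd \<theta>"
      using prime_elem_dvd_multD[OF prime_alpha[OF assms(2)]] u' by (metis dvd_triv_left)+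
    then obtain f g where "fst \<theta> = \<alpha> K * f" "snd \<theta> = \<alpha> K * g"
      by (meson dvdE)
    then have \<rho>: "\<theta> = der_scale (\<alpha> K) (f, g)"
      by (simp add: prod_eq_iff)
    have "der_homogeneous d (der_scale (\<alpha> K) (f, g))" "der_scale (\<alpha> K) (f, g) \<noteq> 0"
      using d unfolding low_def \<rho> by auto
    then have hom: "homogeneous d (f * \<alpha> K)" "homogeneous d (g * \<alpha> K)" and nz: "f \<noteq> 0 \<or> g \<noteq> 0"
      by (auto simp: der_homogeneous_def prod_eq_iff mult.commute[of _ "\<alpha> K"])
    note cancel = homogeneous_cancel[OF homogeneous_lin_form alpha_nonzero[OF assms(2)]]
    \<comment> \<open>This makes \<open>d - 1\<close> a proper decrease, which compensates for
      passing down to the smaller multiplicity \<open>\<mu>\<close>.\<close>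
    have "1 \<le> d"
      using nz cancel(1)[OF hom(1)] cancel(1)[OF hom(2)] by blast
    moreover have "der_homogeneous (d - 1) (f, g)"
      using cancel(2)[OF hom(1)] cancel(2)[OF hom(2)] homogeneous_0
      unfolding der_homogeneous_def fst_conv snd_conv by metis
    moreover have "(f, g) \<in> D \<mu>"
      using d by (simp only: low_def \<rho> scale_alpha_in_D_inc_iff[OF assms(2)])
    moreover have "(f, g) \<noteq> 0"
      using d by (auto simp: low_def \<rho> prod_eq_iff)
    ultimately have "low \<mu> (f, g) (d - 1)"
      using d unfolding low_def size by auto
    then show False using meet by blast
  qed
qed

end

section \<open>The multiplicity lattice\<close>

lemma mult_eqI:
  assumes "\<mu> \<in> multiplicities A" "\<nu> \<in> multiplicities A" "\<And>H. H \<in> A \<Longrightarrow> \<mu> H = \<nu> H"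
  shows "\<mu> = \<nu>"
  using assms unfolding multiplicities_def by (rule PiE_ext)

lemma mult_update_in: "\<mu> \<in> multiplicities A \<Longrightarrow> H \<in> A \<Longrightarrow> \<mu>(H := n) \<in> multiplicities A"
  by (auto simp: multiplicities_def PiE_iff extensional_def)

lemma hasse_adjacent_sym: "hasse_adjacent A \<mu> \<nu> \<longleftrightarrow> hasse_adjacent A \<nu> \<mu>"
  by (auto simp: hasse_adjacent_def)

lemma hasse_adjacent_inc: "finite A \<Longrightarrow> H \<in> A \<Longrightarrow> hasse_adjacent A \<mu> (mult_inc \<mu> H)"
  by (simp add: hasse_adjacent_def mult_covered_def mult_le_def mult_size_inc)

lemma mult_dist_eq_1:
  assumes "finite A" "\<mu> \<in> multiplicities A" "\<nu> \<in> multiplicities A" "mult_dist A \<mu> \<nu> = 1"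
  obtains H where "H \<in> A" "\<nu> = mult_inc \<mu> H" | H where "H \<in> A" "\<mu> = mult_inc \<nu> H"
proof -
  have "\<exists>H\<in>A. nat \<bar>int (\<mu> H) - int (\<nu> H)\<bar> = Suc 0 \<and>
      (\<forall>K\<in>A. H \<noteq> K \<longrightarrow> nat \<bar>int (\<mu> K) - int (\<nu> K)\<bar> = 0)"
    using assms(4) unfolding mult_dist_def One_nat_def sum_eq_Suc0_iff[OF assms(1)] .
  then obtain H where H: "H \<in> A" "nat \<bar>int (\<mu> H) - int (\<nu> H)\<bar> = Suc 0"
      and eq: "\<And>K. K \<in> A \<Longrightarrow> K \<noteq> H \<Longrightarrow> \<mu> K = \<nu> K"
    by fastforce
  from H(2) consider "\<nu> H = Suc (\<mu> H)" | "\<mu> H = Suc (\<nu> H)"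
    by linarith
  then show ?thesis
  proof cases
    case 1
    have "\<nu> = mult_inc \<mu> H"
      by (rule mult_eqI[OF assms(3) mult_update_in[OF assms(2) H(1)]]) (simp add: 1 eq)
    then show ?thesis using that(1) H(1) by blast
  next
    case 2
    have "\<mu> = mult_inc \<nu> H"
      by (rule mult_eqI[OF assms(2) mult_update_in[OF assms(3) H(1)]]) (simp add: 2 eq)
    then show ?thesis using that(2) H(1) by blast
  qed
qed

lemma mult_dist_commute: "mult_dist A \<mu> \<nu> = mult_dist A \<nu> \<mu>"
  unfolding mult_dist_def by (simp add: abs_minus_commute)

lemma mult_dist_self: "mult_dist A \<mu> \<mu> = 0"
  by (simp add: mult_dist_def)

lemma mult_covered_dist:
  assumes "mult_covered A \<mu> \<nu>"
  shows "mult_dist A \<mu> \<nu> = 1"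
proof -
  have "(\<Sum>H\<in>A. nat \<bar>int (\<mu> H) - int (\<nu> H)\<bar>) = (\<Sum>H\<in>A. \<nu> H - \<mu> H)"
    using assms by (intro sum.cong) (auto simp: mult_covered_def mult_le_def)
  also have "\<dots> = (\<Sum>H\<in>A. \<nu> H) - (\<Sum>H\<in>A. \<mu> H)"
    using assms by (intro sum_subtractf_nat) (auto simp: mult_covered_def mult_le_def)
  finally show ?thesis
    using assms by (simp add: mult_dist_def mult_covered_def mult_size_def)
qed

text \<open>At a coordinate where the two differ, raising the smaller value brings them one step
  closer. Which side is raised decides the case.\<close>

lemma mult_dist_eq_Suc:
  assumes "finite A" "mult_dist A \<mu> \<nu> = Suc n"
  obtains H where "H \<in> A" "\<mu> H < \<nu> H" "mult_dist A (mult_inc \<mu> H) \<nu> = n"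
    | H where "H \<in> A" "\<nu> H < \<mu> H" "mult_dist A (mult_inc \<nu> H) \<mu> = n"
proof -
  have step: "mult_dist A (mult_inc \<mu> H) \<nu> = n"
    if "H \<in> A" "\<mu> H < \<nu> H" "mult_dist A \<mu> \<nu> = Suc n" for \<mu> \<nu> H
  proof -
    have "mult_dist A \<mu> \<nu> = nat \<bar>int (\<mu> H) - int (\<nu> H)\<bar> +
        (\<Sum>K\<in>A - {H}. nat \<bar>int (\<mu> K) - int (\<nu> K)\<bar>)" for \<mu> \<nu>
      unfolding mult_dist_def by (rule sum.remove[OF assms(1) that(1)])
    from this[of \<mu> \<nu>] this[of "mult_inc \<mu> H" \<nu>] show ?thesis
      using that(2,3) by simp
  qed
  obtain H where H: "H \<in> A" "\<mu> H \<noteq> \<nu> H"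
    using assms(2) unfolding mult_dist_def
    by (metis (no_types, lifting) abs_zero diff_self nat.distinct(1) nat_zero_as_int of_nat_0 sum.neutral zero_neq_one)
  show ?thesis
  proof (cases "\<mu> H < \<nu> H")
    case True
    then show ?thesis
      using step[OF H(1) True assms(2)] H(1) that(1) by blast
  next
    case False
    then have "\<nu> H < \<mu> H"
      using H(2) by simp
    then show ?thesis
      using step[of H \<nu> \<mu>] H(1) assms(2) that(2) by (simp add: mult_dist_commute)
  qed
qed

text \<open>Up to symmetry, multiplicities at distance two are the ends of an ascending chain of two
  steps or two opposite, incomparable corners of a square with bottom
  \<open>\<kappa>\<close>.\<close>

lemma mult_dist_2_induct:
  assumes "finite A" and \<mu>\<nu>: "\<mu> \<in> multiplicities A" "\<nu> \<in> multiplicities A" "mult_dist A \<mu> \<nu> = 2"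
    and sym: "\<And>\<mu> \<nu>. P \<mu> \<nu> \<Longrightarrow> P \<nu> \<mu>"
    and chain: "\<And>\<kappa> H K. H \<in> A \<Longrightarrow> K \<in> A \<Longrightarrow> \<kappa> \<in> multiplicities A \<Longrightarrow> P \<kappa> (mult_inc (mult_inc \<kappa> H) K)"
    and square: "\<And>\<kappa> H K. H \<in> A \<Longrightarrow> K \<in> A \<Longrightarrow> H \<noteq> K \<Longrightarrow> \<kappa> \<in> multiplicities A \<Longrightarrow>
       P (mult_inc \<kappa> K) (mult_inc \<kappa> H)"
  shows "P \<mu> \<nu>"
proof -
  \<comment> \<open>After the first increment at \<open>H\<close>, the remaining unit step goes up,
    giving a chain, or down at some \<open>K\<close>, giving a square.\<close>
  have *: "P \<mu> \<nu>"
    if "\<mu> \<in> multiplicities A" "\<nu> \<in> multiplicities A" "H \<in> A" "\<mu> H < \<nu> H" "mult_dist A (mult_inc \<mu> H) \<nu> = 1"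
    for \<mu> \<nu> H
    using assms(1) mult_update_in[OF that(1,3)] that(2,5)
  proof (rule mult_dist_eq_1)
    fix K assume "K \<in> A" "\<nu> = mult_inc (mult_inc \<mu> H) K"
    then show ?thesis using chain that(1,3) by blast
  next
    fix K assume K: "K \<in> A" "mult_inc \<mu> H = mult_inc \<nu> K"
    note eq = fun_cong[OF K(2)]
    have "H \<noteq> K"
      using eq[of H] that(4) by auto
    \<comment> \<open>This is the meet of \<open>\<mu>\<close> and \<open>\<nu>\<close>: at
      \<open>K\<close> the value of \<open>\<mu>\<close> exceeds that of \<open>\<nu>\<close> by
      one.\<close>
    define \<kappa> where "\<kappa> = \<mu>(K := \<nu> K)"
    have "mult_inc \<kappa> K = \<mu>"
      using eq[of K] \<open>H \<noteq> K\<close> by (auto simp: \<kappa>_def)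
    moreover have "mult_inc \<kappa> H J = \<nu> J" for J
      using eq[of J] \<open>H \<noteq> K\<close> by (auto simp: \<kappa>_def split: if_splits)
    then have "mult_inc \<kappa> H = \<nu>" by blast
    moreover have "\<kappa> \<in> multiplicities A"
      unfolding \<kappa>_def by (rule mult_update_in[OF that(1) K(1)])
    ultimately show ?thesis
      using square[OF that(3) K(1) \<open>H \<noteq> K\<close>] by metis
  qed
  have "mult_dist A \<mu> \<nu> = Suc 1"
    using \<mu>\<nu>(3) by simp
  then show ?thesis
    by (rule mult_dist_eq_Suc[OF assms(1)]) (use * \<mu>\<nu> sym in blast)+
qed

text \<open>Adjoining \<open>\<nu>\<close> keeps the set connected, since every path can be routed
  through \<open>\<mu>\<close>; maximality then forces \<open>\<nu>\<close> to be a member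
  already.\<close>

lemma maximal_component_closed:
  assumes "maximal_component A L C" "\<mu> \<in> C" "\<nu> \<in> L" "hasse_adjacent A \<mu> \<nu>"
  shows "\<nu> \<in> C"
proof -
  define R where "R X = {(\<kappa>, \<rho>). \<kappa> \<in> X \<and> \<rho> \<in> X \<and> hasse_adjacent A \<kappa> \<rho>}" for X
  have C: "C \<subseteq> L" "\<And>\<kappa> \<rho>. \<kappa> \<in> C \<Longrightarrow> \<rho> \<in> C \<Longrightarrow> (\<kappa>, \<rho>) \<in> (R C)\<^sup>*"
      and max: "\<And>C'. C \<subseteq> C' \<Longrightarrow> C' \<subseteq> L \<Longrightarrow> hasse_connected A C' \<Longrightarrow> C' = C"
    using assms(1) unfolding maximal_component_def hasse_connected_def R_def by blast+
  have mono: "(R C)\<^sup>* \<subseteq> (R (insert \<nu> C))\<^sup>*"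
    by (rule rtrancl_mono) (auto simp: R_def)
  have edges: "(\<mu>, \<nu>) \<in> R (insert \<nu> C)" "(\<nu>, \<mu>) \<in> R (insert \<nu> C)"
    using assms(2,4) hasse_adjacent_sym[of A \<mu> \<nu>] by (auto simp: R_def)
  have "(\<kappa>, \<mu>) \<in> (R (insert \<nu> C))\<^sup>*" "(\<mu>, \<kappa>) \<in> (R (insert \<nu> C))\<^sup>*" if "\<kappa> \<in> insert \<nu> C" for \<kappa>
    using that C(2) assms(2) mono edges by blast+
  then have "(\<kappa>, \<rho>) \<in> (R (insert \<nu> C))\<^sup>*" if "\<kappa> \<in> insert \<nu> C" "\<rho> \<in> insert \<nu> C" for \<kappa> \<rho>
    using that by (meson rtrancl_trans)
  then have "hasse_connected A (insert \<nu> C)"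
    unfolding hasse_connected_def R_def by blast
  then have "insert \<nu> C = C"
    using C(1) assms(3) by (intro max) auto
  then show ?thesis by blast
qed

lemma set_dist_le: "\<mu> \<in> C \<Longrightarrow> \<mu>' \<in> C' \<Longrightarrow> set_dist A C C' \<le> mult_dist A \<mu> \<mu>'"
  unfolding set_dist_def by (rule cInf_lower) auto

lemma set_dist_attained:
  assumes "C \<noteq> {}" "C' \<noteq> {}"
  obtains \<mu> \<mu>' where "\<mu> \<in> C" "\<mu>' \<in> C'" "mult_dist A \<mu> \<mu>' = set_dist A C C'"
proof -
  have "{mult_dist A \<mu> \<mu>' | \<mu> \<mu>'. \<mu> \<in> C \<and> \<mu>' \<in> C'} \<noteq> {}"
    using assms by blast
  from Inf_nat_def1[OF this] show ?thesis
    using that unfolding set_dist_def by auto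
qed

section \<open>Components of the unbalanced multiplicities\<close>

context line_arrangement
begin

lemma unbalanced_iff: "\<mu> \<in> unbalanced_mults A \<alpha> \<longleftrightarrow> \<mu> \<in> multiplicities A \<and> (\<exists>\<delta> d. low \<mu> \<delta> d)"
  by (simp add: unbalanced_mults_def exp_diff_pos_iff)

text \<open>\<open>\<theta>\<close> selects one lower basis element for every unbalanced
  multiplicity; the results hold for any such selection.\<close>

context
  fixes \<theta> :: "('h \<Rightarrow> nat) \<Rightarrow> 'k derivation"
  assumes theta: "\<And>\<mu>. \<mu> \<in> unbalanced_mults A \<alpha> \<Longrightarrow> is_lower_basis_element A \<alpha> \<mu> (\<theta> \<mu>)"
begin

lemma theta_low:
  assumes "\<mu> \<in> unbalanced_mults A \<alpha>"
  obtains d where "low \<mu> (\<theta> \<mu>) d"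
  using lower_basis_element_low[OF theta[OF assms]] by blast

lemma theta_nonzero: "\<mu> \<in> unbalanced_mults A \<alpha> \<Longrightarrow> \<theta> \<mu> \<noteq> 0"
  by (metis theta_low low_def)

lemma adjacent_dependent:
  assumes "\<mu> \<in> unbalanced_mults A \<alpha>" "\<nu> \<in> unbalanced_mults A \<alpha>" "hasse_adjacent A \<mu> \<nu>"
  shows "det (\<theta> \<mu>) (\<theta> \<nu>) = 0"
proof -
  obtain d e where low: "low \<mu> (\<theta> \<mu>) d" "low \<nu> (\<theta> \<nu>) e"
    using theta_low assms(1,2) by metis
  have "\<mu> \<in> multiplicities A" "\<nu> \<in> multiplicities A"
    using assms(1,2) by (simp_all add: unbalanced_iff)
  moreover have "mult_dist A \<mu> \<nu> = 1"
    using assms(3) mult_covered_dist mult_dist_commute unfolding hasse_adjacent_def by metis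
  ultimately show ?thesis
  proof (rule mult_dist_eq_1[OF finite_A])
    fix H assume H: "H \<in> A" "\<nu> = mult_inc \<mu> H"
    show ?thesis
      using low_inc_dependent[OF H(1) low(1)] low(2) H(2) by blast
  next
    fix H assume H: "H \<in> A" "\<mu> = mult_inc \<nu> H"
    have "det (\<theta> \<nu>) (\<theta> \<mu>) = 0"
      using low_inc_dependent[OF H(1) low(2)] low(1) H(2) by blast
    then show ?thesis
      using det_swap[of "\<theta> \<mu>" "\<theta> \<nu>"] by simp
  qed
qed

lemma component_dependent:
  assumes "maximal_component A (unbalanced_mults A \<alpha>) C" "\<mu> \<in> C" "\<nu> \<in> C"
  shows "det (\<theta> \<mu>) (\<theta> \<nu>) = 0"
proof -
  have C: "C \<subseteq> unbalanced_mults A \<alpha>"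
    using assms(1) unfolding maximal_component_def by blast
  have "(\<mu>, \<nu>) \<in> {(\<kappa>, \<rho>). \<kappa> \<in> C \<and> \<rho> \<in> C \<and> hasse_adjacent A \<kappa> \<rho>}\<^sup>*"
    using assms unfolding maximal_component_def hasse_connected_def by blast
  then show ?thesis
  proof (induction rule: rtrancl_induct)
    case base
    then show ?case by (simp add: det_def)
  next
    case (step \<kappa> \<rho>)
    then have "\<kappa> \<in> unbalanced_mults A \<alpha>" "\<rho> \<in> unbalanced_mults A \<alpha>" "hasse_adjacent A \<kappa> \<rho>"
      using C by auto
    then show ?case
      \<comment> \<open>Transitivity applies because the intermediate derivation
        \<open>\<theta> \<kappa>\<close> is nonzero.\<close>
      using det_eq_0_trans[OF step(3) adjacent_dependent theta_nonzero] by blast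
  qed
qed

text \<open>The condition \<open>between\<close> makes the common neighbours balanced: the
  intermediate multiplicities of a chain, or the meet and the join of a square.\<close>

lemma distance_two_independent:
  assumes "\<mu> \<in> unbalanced_mults A \<alpha>" "\<mu>' \<in> unbalanced_mults A \<alpha>" "mult_dist A \<mu> \<mu>' = 2"
    and between: "\<And>\<nu>. hasse_adjacent A \<mu> \<nu> \<Longrightarrow> hasse_adjacent A \<nu> \<mu>' \<Longrightarrow> \<nu> \<notin> unbalanced_mults A \<alpha>"
  shows "det (\<theta> \<mu>) (\<theta> \<mu>') \<noteq> 0"
proof -
  \<comment> \<open>The hypotheses are built into \<open>P\<close> to make it a symmetric relation
    on all pairs, as the case distinction demands.\<close>
  define P where "P \<mu> \<mu>' \<longleftrightarrow> (\<mu> \<in> unbalanced_mults A \<alpha> \<longrightarrow> \<mu>' \<in> unbalanced_mults A \<alpha> \<longrightarrow>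
    (\<forall>\<nu>. hasse_adjacent A \<mu> \<nu> \<longrightarrow> hasse_adjacent A \<nu> \<mu>' \<longrightarrow> \<nu> \<notin> unbalanced_mults A \<alpha>) \<longrightarrow>
    det (\<theta> \<mu>) (\<theta> \<mu>') \<noteq> 0)" for \<mu> \<mu>'
  have "\<mu> \<in> multiplicities A" "\<mu>' \<in> multiplicities A"
    using assms(1,2) by (simp_all add: unbalanced_iff)
  from finite_A this assms(3) have "P \<mu> \<mu>'"
  proof (rule mult_dist_2_induct)
    show "P \<nu> \<mu>" if "P \<mu> \<nu>" for \<mu> \<nu>
    proof -
      have "det (\<theta> \<nu>) (\<theta> \<mu>) = 0 \<longleftrightarrow> det (\<theta> \<mu>) (\<theta> \<nu>) = 0"
        unfolding det_swap[of "\<theta> \<nu>" "\<theta> \<mu>"] by (rule neg_equal_0_iff_equal)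
      with that show ?thesis
        unfolding P_def hasse_adjacent_sym[of A \<nu>] hasse_adjacent_sym[of A _ \<mu>] by blast
    qed
  next
    fix \<kappa> H K assume 2: "H \<in> A" "K \<in> A" "\<kappa> \<in> multiplicities A"
    let ?\<nu> = "mult_inc (mult_inc \<kappa> H) K"
    have comm: "?\<nu> = mult_inc (mult_inc \<kappa> K) H"
      by (auto simp: fun_upd_def)
    show "P \<kappa> ?\<nu>"
      unfolding P_def
    proof (intro impI)
      assume *: "\<kappa> \<in> unbalanced_mults A \<alpha>" "?\<nu> \<in> unbalanced_mults A \<alpha>"
        "\<forall>\<nu>. hasse_adjacent A \<kappa> \<nu> \<longrightarrow> hasse_adjacent A \<nu> ?\<nu> \<longrightarrow> \<nu> \<notin> unbalanced_mults A \<alpha>"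
      have "mult_inc \<kappa> H \<notin> unbalanced_mults A \<alpha>"
        using *(3) hasse_adjacent_inc[OF finite_A 2(1), of \<kappa>]
          hasse_adjacent_inc[OF finite_A 2(2), of "mult_inc \<kappa> H"] by blast
      moreover have "mult_inc \<kappa> K \<notin> unbalanced_mults A \<alpha>"
        using *(3) hasse_adjacent_inc[OF finite_A 2(2), of \<kappa>]
          hasse_adjacent_inc[OF finite_A 2(1), of "mult_inc \<kappa> K"] unfolding comm by blast
      ultimately have notlow: "\<not> low (mult_inc \<kappa> H) \<delta> d" "\<not> low (mult_inc \<kappa> K) \<delta> d" for \<delta> d
        using mult_update_in[OF 2(3,1)] mult_update_in[OF 2(3,2)] unfolding unbalanced_iff by blast+
      obtain d where "low ?\<nu> (\<theta> ?\<nu>) d"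
        using theta_low[OF *(2)] .
      then show "det (\<theta> \<kappa>) (\<theta> ?\<nu>) \<noteq> 0"
        by (rule independent_chain[OF 2(1,2) theta[OF *(1)] _ notlow])
    qed
  next
    fix \<kappa> H K assume 3: "H \<in> A" "K \<in> A" "H \<noteq> K" "\<kappa> \<in> multiplicities A"
    let ?\<nu> = "mult_inc (mult_inc \<kappa> H) K"
    have comm: "?\<nu> = mult_inc (mult_inc \<kappa> K) H"
      by (auto simp: fun_upd_def)
    show "P (mult_inc \<kappa> K) (mult_inc \<kappa> H)"
      unfolding P_def
    proof (intro impI)
      assume *: "mult_inc \<kappa> K \<in> unbalanced_mults A \<alpha>" "mult_inc \<kappa> H \<in> unbalanced_mults A \<alpha>"
        "\<forall>\<nu>. hasse_adjacent A (mult_inc \<kappa> K) \<nu> \<longrightarrow> hasse_adjacent A \<nu> (mult_inc \<kappa> H) \<longrightarrow>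
           \<nu> \<notin> unbalanced_mults A \<alpha>"
      have "\<kappa> \<notin> unbalanced_mults A \<alpha>"
        using *(3) hasse_adjacent_inc[OF finite_A 3(1), of \<kappa>] hasse_adjacent_inc[OF finite_A 3(2), of \<kappa>]
          hasse_adjacent_sym[of A \<kappa> "mult_inc \<kappa> K"] by blast
      moreover have "hasse_adjacent A (mult_inc \<kappa> K) ?\<nu>"
        unfolding comm by (rule hasse_adjacent_inc[OF finite_A 3(1)])
      then have "?\<nu> \<notin> unbalanced_mults A \<alpha>"
        using *(3) hasse_adjacent_inc[OF finite_A 3(2), of "mult_inc \<kappa> H"]
          hasse_adjacent_sym[of A "mult_inc \<kappa> H" ?\<nu>] by blast
      ultimately have notlow: "\<not> low \<kappa> \<delta> d" "\<not> low ?\<nu> \<delta> d" for \<delta> d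
        using 3(4) mult_update_in[OF mult_update_in[OF 3(4,1)] 3(2)] unfolding unbalanced_iff by blast+
      obtain d where "low (mult_inc \<kappa> H) (\<theta> (mult_inc \<kappa> H)) d"
        using theta_low[OF *(2)] .
      then show "det (\<theta> (mult_inc \<kappa> K)) (\<theta> (mult_inc \<kappa> H)) \<noteq> 0"
        by (rule independent_antichain[OF 3(1-3) theta[OF *(1)] _ notlow])
    qed
  qed
  then show ?thesis
    using assms unfolding P_def by blast
qed

lemma components_independent:
  assumes C: "maximal_component A (unbalanced_mults A \<alpha>) C"
    and C': "maximal_component A (unbalanced_mults A \<alpha>) C'"
    and dist: "set_dist A C C' = 2"
    and "\<mu> \<in> C" "\<mu>' \<in> C'"
  shows "det (\<theta> \<mu>) (\<theta> \<mu>') \<noteq> 0"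
proof -
  have sub: "C \<subseteq> unbalanced_mults A \<alpha>" "C' \<subseteq> unbalanced_mults A \<alpha>"
    using C C' unfolding maximal_component_def by blast+
  \<comment> \<open>A pair realising the distance of the components. An unbalanced common neighbour
    would lie in both components and make their distance zero.\<close>
  obtain \<kappa> \<kappa>' where \<kappa>: "\<kappa> \<in> C" "\<kappa>' \<in> C'" "mult_dist A \<kappa> \<kappa>' = 2"
    using set_dist_attained[of C C' A] assms(4,5) dist by auto
  have "\<nu> \<notin> unbalanced_mults A \<alpha>" if "hasse_adjacent A \<kappa> \<nu>" "hasse_adjacent A \<nu> \<kappa>'" for \<nu>
  proof
    assume "\<nu> \<in> unbalanced_mults A \<alpha>"
    then have "\<nu> \<in> C" "\<nu> \<in> C'"
      using maximal_component_closed[OF C \<kappa>(1)] maximal_component_closed[OF C' \<kappa>(2)] that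
        hasse_adjacent_sym[of A \<nu> \<kappa>'] by blast+
    then show False
      using set_dist_le[of \<nu> C \<nu> C' A] dist by (simp add: mult_dist_self)
  qed
  then have "det (\<theta> \<kappa>) (\<theta> \<kappa>') \<noteq> 0"
    using distance_two_independent sub \<kappa> by blast
  moreover have "det (\<theta> \<kappa>) (\<theta> \<mu>) = 0" "det (\<theta> \<mu>') (\<theta> \<kappa>') = 0"
    using component_dependent C C' \<kappa>(1,2) assms(4,5) by blast+
  moreover have "\<theta> \<mu> \<noteq> 0" "\<theta> \<mu>' \<noteq> 0"
    using theta_nonzero sub assms(4,5) by blast+
  \<comment> \<open>If \<open>\<theta> \<mu>\<close> and \<open>\<theta> \<mu>'\<close> were
    dependent, transitivity along \<open>\<kappa>\<close>, \<open>\<mu>\<close>,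
    \<open>\<mu>'\<close>, \<open>\<kappa>'\<close> would make the chosen pair dependent.\<close>
  ultimately show ?thesis
    using det_eq_0_trans by metis
qed

end

end

section \<open>Lines in a plane\<close>

text \<open>A form is determined by its values on \<open>e1\<close> and \<open>e2\<close>. If both
  vanish, its kernel is the whole plane and not a line; if two forms divide one another, they are
  proportional and have equal kernels.\<close>

lemma line_arrangement_of_forms:
  fixes scale :: "'k::field \<Rightarrow> 'v::ab_group_add \<Rightarrow> 'v"
  assumes V: "vector_space scale" "vector_space.dim scale (UNIV :: 'v set) = 2"
    and span: "module.span scale {e1, e2} = UNIV"
    and finite: "finite A"
    and lines: "\<And>H. H \<in> A \<Longrightarrow> vector_space.dim scale H = 1"
    and forms: "\<And>H. H \<in> A \<Longrightarrow> Vector_Spaces.linear scale (*) (form H) \<and> {v. form H v = 0} = H"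
  shows "line_arrangement A (\<lambda>H. form H e1) (\<lambda>H. form H e2)"
proof
  interpret V: vector_space scale by (rule V(1))
  have comb: "\<exists>r s. v = scale r e1 + scale s e2" for v
  proof -
    have "v \<in> V.span {e1, e2}" using span by simp
    then show ?thesis
      unfolding V.span_insert V.span_empty by (auto simp: algebra_simps)
  qed
  have form_comb: "form H (scale r e1 + scale s e2) = r * form H e1 + s * form H e2" if "H \<in> A" for H r s
  proof -
    interpret Vector_Spaces.linear scale "(*)" "form H" using forms[OF that] by blast
    show ?thesis by (simp add: add scale)
  qed
  show nz: "form H e1 \<noteq> 0 \<or> form H e2 \<noteq> 0" if "H \<in> A" for H
  proof (rule ccontr)
    assume "\<not> ?thesis"
    then have "form H v = 0" for v
      using form_comb[OF that] comb[of v] by auto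
    then have "H = UNIV" using forms[OF that] by auto
    then show False using lines[OF that] V(2) by simp
  qed
  show "\<not> lin_form (form H e1) (form H e2) dvd lin_form (form K e1) (form K e2)"
    if HK: "H \<in> A" "K \<in> A" "H \<noteq> K" for H K
  proof
    assume "lin_form (form H e1) (form H e2) dvd lin_form (form K e1) (form K e2)"
    then obtain q where q: "lin_form (form K e1) (form K e2) = q * lin_form (form H e1) (form H e2)"
      by (metis dvdE mult.commute)
    have "lin_form (form H e1) (form H e2) \<noteq> 0" "lin_form (form K e1) (form K e2) \<noteq> 0"
      using nz HK by (simp_all add: lin_form_eq_0_iff)
    moreover from this have "q \<noteq> 0" using q by auto
    \<comment> \<open>The quotient of two forms of degree one has degree zero, so it is a
      scalar.\<close>
    ultimately have "homogeneous (1 - 1) q"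
      using homogeneous_cancel(2)[OF homogeneous_lin_form] homogeneous_lin_form q by metis
    then obtain c where c: "q = [:[:c:]:]"
      using homogeneous_0E by auto
    have "c \<noteq> 0" using c \<open>q \<noteq> 0\<close> by auto
    have "form K e1 = c * form H e1" "form K e2 = c * form H e2"
      using q \<open>c \<noteq> 0\<close> by (simp_all add: c lin_form_def)
    then have "form K (scale r e1 + scale s e2) = c * form H (scale r e1 + scale s e2)" for r s
      using HK by (simp add: form_comb algebra_simps)
    then have "form K v = c * form H v" for v
      using comb[of v] by auto
    then have "{v. form K v = 0} = {v. form H v = 0}"
      using \<open>c \<noteq> 0\<close> by auto
    then show False
      using forms[OF HK(1)] forms[OF HK(2)] HK(3) by simp
  qed
qed (rule finite)

theorem theorem3p4:
  fixes scale :: "'k::field \<Rightarrow> 'v::ab_group_add \<Rightarrow> 'v"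
    and e1 e2 :: 'v
    and A :: "'v set set"
    and form :: "'v set \<Rightarrow> 'v \<Rightarrow> 'k"
    and \<alpha> :: "'v set \<Rightarrow> 'k poly poly"
    and \<theta> :: "('v set \<Rightarrow> nat) \<Rightarrow> 'k derivation"
  assumes V: "vector_space scale" "vector_space.dim scale (UNIV :: 'v set) = 2"
    and basis: "e1 \<noteq> e2" "\<not> module.dependent scale {e1, e2}" "module.span scale {e1, e2} = UNIV"
    and finite_A: "finite A"
    and lines: "\<And>H. H \<in> A \<Longrightarrow> module.subspace scale H \<and> vector_space.dim scale H = 1"
    and forms: "\<And>H. H \<in> A \<Longrightarrow> Vector_Spaces.linear scale (*) (form H) \<and> {v. form H v = 0} = H"
    and alpha: "\<alpha> = (\<lambda>H. form_poly e1 e2 (form H))"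
    and theta: "\<And>\<mu>. \<mu> \<in> unbalanced_mults A \<alpha> \<Longrightarrow> is_lower_basis_element A \<alpha> \<mu> (\<theta> \<mu>)"
  shows "(\<forall>C C'. maximal_component A (unbalanced_mults A \<alpha>) C \<and>
            maximal_component A (unbalanced_mults A \<alpha>) C' \<and>
            finite C \<and> finite C' \<and> set_dist A C C' = 2 \<longrightarrow>
            (\<forall>\<mu>\<in>C. \<forall>\<mu>'\<in>C'. S_independent (\<theta> \<mu>) (\<theta> \<mu>'))) \<and>
         (\<forall>C. maximal_component A (unbalanced_mults A \<alpha>) C \<longrightarrow>
            (\<forall>\<mu>\<in>C. \<forall>\<mu>'\<in>C. S_dependent (\<theta> \<mu>) (\<theta> \<mu>')))"
proof -
  interpret line_arrangement A "\<lambda>H. form H e1" "\<lambda>H. form H e2"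
    using line_arrangement_of_forms[OF V basis(3) finite_A] lines forms by blast
  \<comment> \<open>The forms in the statement are identified with those of the locale, so that its
    results apply to the given \<open>\<theta>\<close>.\<close>
  have \<alpha>: "\<alpha> = (\<lambda>H. lin_form (form H e1) (form H e2))"
    unfolding alpha by (simp add: form_poly_eq)
  note theta' = theta[unfolded \<alpha>]
  show ?thesis
    unfolding S_independent_iff \<alpha>
    using components_independent[of \<theta>, OF theta'] component_dependent[of \<theta>, OF theta'] by blast
qed

end
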